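(* For every set $X \subseteq \omega$, the $X$-computable entailment relation $C(X) = \{ \ulcorner \varphi \urcorner : \ \models_c^X \varphi \}$ is $\Pi^1_1(X)$ complete; that is, $C(X)$ is a $\Pi^1_1(X)$ set, and $A \leq_1 C(X)$ for every $\Pi^1_1(X)$ set $A \subseteq \omega$.
   Context: The language $\mathrm{L}_2$ of second order arithmetic is the two-sorted first order language with number variables, set variables, constants $0, 1$, binary function symbols $+, \cdot$, and binary relation symbols $<$ and $\in$. An $\omega$-model is an $\mathrm{L}_2$-structure whose first order part is the standard natural numbers $\omega$ with the standard arithmetical operations and order, and whose second order part is some $\mathcal{S} \subseteq \mathcal{P}(\omega)$; it is identified with $\mathcal{S}$. For $X, Y \subseteq \omega$, the recursive join is $X \oplus Y = \{2x : x \in X\} \cup \{2y+1 : y \in Y\}$. A Turing ideal is a class $M \subseteq \mathcal{P}(\omega)$ closed under Turing reducibility (if $A \in M$ and $B \leq_{\mathbf{T}} A$ then $B \in M$) and under recursive joins; Turing ideals are regarded as $\omega$-models. For $X \subseteq \omega$ and a sentence $\varphi$ of $\mathrm{L}_2$ expanded by a constant symbol $\overline{X}$ denoting $X$, we say that $\varphi$ is $X$-computably entailed, written $\models_c^X \varphi$, iff $M \models \varphi$ for every Turing ideal $M$ with $X \in M$. Fix a recursive, bijective Gödel coding $\varphi \mapsto \ulcorner\varphi\urcorner$ of sentences. Then $C(X)$ is the set of Gödel codes of $\mathrm{L}_2$-sentences $\varphi$, possibly containing the constant $\overline{X}$, such that $\models_c^X \varphi$. A set $A \subseteq \omega$ is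 $\Pi^1_1(X)$ if $A = \{ n \in \omega : \varphi(n, X) \}$ for some $\Pi^1_1$ formula $\varphi(m_1, X_1)$ of $\mathrm{L}_2$, evaluated in the full model $(\omega, \mathcal{P}(\omega))$. For $A, B \subseteq \omega$, $A \leq_1 B$ ($A$ is $1$-reducible to $B$) means there is a total recursive injective $f : \omega \to \omega$ with $m \in A \Leftrightarrow f(m) \in B$ for all $m \in \omega$. A set $B$ is complete for a class $\mathcal{X} \subseteq \mathcal{P}(\omega)$ iff $B \in \mathcal{X}$ and $A \leq_1 B$ for every $A \in \mathcal{X}$. *)

theory Defs
  imports Main "HOL-Library.Nat_Bijection"
begin

section \<open>Oracle computability\<close>

text \<open>Kleene's schemata for the functions partial recursive in an oracle.  Arities are not tracked:
  \<open>Succ\<close> and \<open>Oracle\<close> read only the first argument, and a program applied to too few arguments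
  has no value.  On argument lists of any fixed length the programs still compute exactly the
  functions partial recursive in the oracle.\<close>

datatype prog =
    Zero
  | Succ
  | Proj nat
  | Oracle
  | Comp prog "prog list"
  | Prim prog prog
  | Minim prog

inductive computes :: "nat set \<Rightarrow> prog \<Rightarrow> nat list \<Rightarrow> nat \<Rightarrow> bool" for A :: "nat set" where
  "computes A Zero xs 0"
| "computes A Succ (x # xs) (Suc x)"
| "i < length xs \<Longrightarrow> computes A (Proj i) xs (xs ! i)"
| "computes A Oracle (x # xs) (if x \<in> A then 1 else 0)"
| "list_all2 (\<lambda>q y. computes A q xs y) qs ys \<Longrightarrow> computes A p ys z \<Longrightarrow>
     computes A (Comp p qs) xs z"
| "computes A p xs y \<Longrightarrow> computes A (Prim p q) (0 # xs) y"
| "computes A (Prim p q) (n # xs) y \<Longrightarrow> computes A q (n # y # xs) z \<Longrightarrow>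
     computes A (Prim p q) (Suc n # xs) z"
| "computes A p (n # xs) 0 \<Longrightarrow> \<forall>m<n. \<exists>y. computes A p (m # xs) (Suc y) \<Longrightarrow>
     computes A (Minim p) xs n"

definition computable_in :: "nat set \<Rightarrow> (nat \<Rightarrow> nat) \<Rightarrow> bool" where
  "computable_in A f \<longleftrightarrow> (\<exists>p. \<forall>x. computes A p [x] (f x))"

definition recursive_fun :: "(nat \<Rightarrow> nat) \<Rightarrow> bool" where
  "recursive_fun f \<longleftrightarrow> computable_in {} f"

definition turing_le :: "nat set \<Rightarrow> nat set \<Rightarrow> bool" (infix "\<le>\<^sub>T" 50) where
  "B \<le>\<^sub>T A \<longleftrightarrow> computable_in A (\<lambda>x. if x \<in> B then 1 else 0)"

definition one_le :: "nat set \<Rightarrow> nat set \<Rightarrow> bool" (infix "\<le>\<^sub>1" 50) where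
  "A \<le>\<^sub>1 B \<longleftrightarrow> (\<exists>f. recursive_fun f \<and> inj f \<and> (\<forall>m. m \<in> A \<longleftrightarrow> f m \<in> B))"

definition complete_for :: "nat set set \<Rightarrow> nat set \<Rightarrow> bool" where
  "complete_for \<X> B \<longleftrightarrow> B \<in> \<X> \<and> (\<forall>A\<in>\<X>. A \<le>\<^sub>1 B)"

definition rec_join :: "nat set \<Rightarrow> nat set \<Rightarrow> nat set" (infixl "\<oplus>" 65) where
  "X \<oplus> Y = {2 * x | x. x \<in> X} \<union> {2 * y + 1 | y. y \<in> Y}"

definition turing_ideal :: "nat set set \<Rightarrow> bool" where
  "turing_ideal M \<longleftrightarrow>
     (\<forall>A B. A \<in> M \<longrightarrow> B \<le>\<^sub>T A \<longrightarrow> B \<in> M) \<and> (\<forall>A B. A \<in> M \<longrightarrow> B \<in> M \<longrightarrow> A \<oplus> B \<in> M)"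


section \<open>Second order arithmetic with a set constant\<close>

text \<open>\<open>SConst\<close> is the additional constant symbol for the distinguished set \<open>X\<close>; formulas of
  \<open>L\<^sub>2\<close> proper are those satisfying \<open>in_L2\<close>.  Equality is between numbers only, equality of sets
  being defined by extensionality; the remaining connectives and the existential quantifiers are
  the usual abbreviations.\<close>

datatype num_term =
    NVar nat
  | NZero
  | NOne
  | Plus num_term num_term
  | Times num_term num_term

datatype set_term = SVar nat | SConst

datatype fm =
    Eq num_term num_term
  | Less num_term num_term
  | Mem num_term set_term
  | Neg fm
  | Conj fm fm
  | AllN nat fm
  | AllS nat fm

fun nval :: "(nat \<Rightarrow> nat) \<Rightarrow> num_term \<Rightarrow> nat" where
  "nval e (NVar i) = e i"
| "nval e NZero = 0"
| "nval e NOne = 1"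
| "nval e (Plus s t) = nval e s + nval e t"
| "nval e (Times s t) = nval e s * nval e t"

fun sval :: "nat set \<Rightarrow> (nat \<Rightarrow> nat set) \<Rightarrow> set_term \<Rightarrow> nat set" where
  "sval X E (SVar i) = E i"
| "sval X E SConst = X"

text \<open>Satisfaction in the \<open>\<omega>\<close>-model \<open>M\<close>, the set constant being interpreted as \<open>X\<close>.\<close>

fun sat :: "nat set set \<Rightarrow> nat set \<Rightarrow> (nat \<Rightarrow> nat) \<Rightarrow> (nat \<Rightarrow> nat set) \<Rightarrow> fm \<Rightarrow> bool" where
  "sat M X e E (Eq s t) \<longleftrightarrow> nval e s = nval e t"
| "sat M X e E (Less s t) \<longleftrightarrow> nval e s < nval e t"
| "sat M X e E (Mem t S) \<longleftrightarrow> nval e t \<in> sval X E S"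
| "sat M X e E (Neg \<phi>) \<longleftrightarrow> \<not> sat M X e E \<phi>"
| "sat M X e E (Conj \<phi> \<psi>) \<longleftrightarrow> sat M X e E \<phi> \<and> sat M X e E \<psi>"
| "sat M X e E (AllN i \<phi>) \<longleftrightarrow> (\<forall>n. sat M X (e(i := n)) E \<phi>)"
| "sat M X e E (AllS i \<phi>) \<longleftrightarrow> (\<forall>Y\<in>M. sat M X e (E(i := Y)) \<phi>)"

fun tm_nvars :: "num_term \<Rightarrow> nat set" where
  "tm_nvars (NVar i) = {i}"
| "tm_nvars NZero = {}"
| "tm_nvars NOne = {}"
| "tm_nvars (Plus s t) = tm_nvars s \<union> tm_nvars t"
| "tm_nvars (Times s t) = tm_nvars s \<union> tm_nvars t"

fun free_nvars :: "fm \<Rightarrow> nat set" where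
  "free_nvars (Eq s t) = tm_nvars s \<union> tm_nvars t"
| "free_nvars (Less s t) = tm_nvars s \<union> tm_nvars t"
| "free_nvars (Mem t S) = tm_nvars t"
| "free_nvars (Neg \<phi>) = free_nvars \<phi>"
| "free_nvars (Conj \<phi> \<psi>) = free_nvars \<phi> \<union> free_nvars \<psi>"
| "free_nvars (AllN i \<phi>) = free_nvars \<phi> - {i}"
| "free_nvars (AllS i \<phi>) = free_nvars \<phi>"

fun tm_svars :: "set_term \<Rightarrow> nat set" where
  "tm_svars (SVar i) = {i}"
| "tm_svars SConst = {}"

fun free_svars :: "fm \<Rightarrow> nat set" where
  "free_svars (Eq s t) = {}"
| "free_svars (Less s t) = {}"
| "free_svars (Mem t S) = tm_svars S"
| "free_svars (Neg \<phi>) = free_svars \<phi>"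
| "free_svars (Conj \<phi> \<psi>) = free_svars \<phi> \<union> free_svars \<psi>"
| "free_svars (AllN i \<phi>) = free_svars \<phi>"
| "free_svars (AllS i \<phi>) = free_svars \<phi> - {i}"

definition sentence :: "fm \<Rightarrow> bool" where
  "sentence \<phi> \<longleftrightarrow> free_nvars \<phi> = {} \<and> free_svars \<phi> = {}"

fun in_L2 :: "fm \<Rightarrow> bool" where
  "in_L2 (Eq s t) \<longleftrightarrow> True"
| "in_L2 (Less s t) \<longleftrightarrow> True"
| "in_L2 (Mem t S) \<longleftrightarrow> S \<noteq> SConst"
| "in_L2 (Neg \<phi>) \<longleftrightarrow> in_L2 \<phi>"
| "in_L2 (Conj \<phi> \<psi>) \<longleftrightarrow> in_L2 \<phi> \<and> in_L2 \<psi>"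
| "in_L2 (AllN i \<phi>) \<longleftrightarrow> in_L2 \<phi>"
| "in_L2 (AllS i \<phi>) \<longleftrightarrow> in_L2 \<phi>"

fun arithmetical :: "fm \<Rightarrow> bool" where
  "arithmetical (Eq s t) \<longleftrightarrow> True"
| "arithmetical (Less s t) \<longleftrightarrow> True"
| "arithmetical (Mem t S) \<longleftrightarrow> True"
| "arithmetical (Neg \<phi>) \<longleftrightarrow> arithmetical \<phi>"
| "arithmetical (Conj \<phi> \<psi>) \<longleftrightarrow> arithmetical \<phi> \<and> arithmetical \<psi>"
| "arithmetical (AllN i \<phi>) \<longleftrightarrow> arithmetical \<phi>"
| "arithmetical (AllS i \<phi>) \<longleftrightarrow> False"

definition Pi11_formula :: "fm \<Rightarrow> bool" where
  "Pi11_formula \<phi> \<longleftrightarrow> (\<exists>i \<theta>. \<phi> = AllS i \<theta> \<and> arithmetical \<theta>)"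

text \<open>The formula \<open>\<phi>(m\<^sub>1, X\<^sub>1)\<close> belongs to \<open>L\<^sub>2\<close> and is evaluated in the full model, with
  \<open>m\<^sub>1\<close> and \<open>X\<^sub>1\<close> (the variables of index 1) denoting \<open>n\<close> and \<open>X\<close>; the values assigned to the
  other variables and to the set constant are irrelevant.\<close>

definition Pi11 :: "nat set \<Rightarrow> nat set set" where
  "Pi11 X = {A. \<exists>\<phi>. Pi11_formula \<phi> \<and> in_L2 \<phi> \<and> free_nvars \<phi> \<subseteq> {1} \<and> free_svars \<phi> \<subseteq> {1} \<and>
     A = {n. sat UNIV {} ((\<lambda>_. 0)(1 := n)) ((\<lambda>_. {})(1 := X)) \<phi>}}"


section \<open>Goedel codings and computable entailment\<close>

text \<open>A fixed structural (injective, not surjective) numbering of the syntax, needed only to say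
  what it means for a coding of sentences to be recursive.\<close>

fun num_term_index :: "num_term \<Rightarrow> nat" where
  "num_term_index (NVar i) = prod_encode (0, i)"
| "num_term_index NZero = prod_encode (1, 0)"
| "num_term_index NOne = prod_encode (2, 0)"
| "num_term_index (Plus s t) = prod_encode (3, prod_encode (num_term_index s, num_term_index t))"
| "num_term_index (Times s t) = prod_encode (4, prod_encode (num_term_index s, num_term_index t))"

fun set_term_index :: "set_term \<Rightarrow> nat" where
  "set_term_index (SVar i) = prod_encode (0, i)"
| "set_term_index SConst = prod_encode (1, 0)"

fun fm_index :: "fm \<Rightarrow> nat" where
  "fm_index (Eq s t) = prod_encode (0, prod_encode (num_term_index s, num_term_index t))"
| "fm_index (Less s t) = prod_encode (1, prod_encode (num_term_index s, num_term_index t))"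
| "fm_index (Mem t S) = prod_encode (2, prod_encode (num_term_index t, set_term_index S))"
| "fm_index (Neg \<phi>) = prod_encode (3, fm_index \<phi>)"
| "fm_index (Conj \<phi> \<psi>) = prod_encode (4, prod_encode (fm_index \<phi>, fm_index \<psi>))"
| "fm_index (AllN i \<phi>) = prod_encode (5, prod_encode (i, fm_index \<phi>))"
| "fm_index (AllS i \<phi>) = prod_encode (6, prod_encode (i, fm_index \<phi>))"

text \<open>The inverse of such a coding is recursive as well, since it can be found by search.\<close>

definition goedel_coding :: "(fm \<Rightarrow> nat) \<Rightarrow> bool" where
  "goedel_coding code \<longleftrightarrow>
     bij_betw code {\<phi>. sentence \<phi>} UNIV \<and>
     (\<exists>f. recursive_fun f \<and> (\<forall>\<phi>. sentence \<phi> \<longrightarrow> code \<phi> = f (fm_index \<phi>)))"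

definition models :: "nat set set \<Rightarrow> nat set \<Rightarrow> fm \<Rightarrow> bool" where
  "models M X \<phi> \<longleftrightarrow> (\<forall>e E. range E \<subseteq> M \<longrightarrow> sat M X e E \<phi>)"

definition comp_entailed :: "nat set \<Rightarrow> fm \<Rightarrow> bool" where
  "comp_entailed X \<phi> \<longleftrightarrow> (\<forall>M. turing_ideal M \<longrightarrow> X \<in> M \<longrightarrow> models M X \<phi>)"

definition comp_entailment :: "(fm \<Rightarrow> nat) \<Rightarrow> nat set \<Rightarrow> nat set" where
  "comp_entailment code X = {code \<phi> | \<phi>. sentence \<phi> \<and> comp_entailed X \<phi>}"

end

theory Submission
  imports Defs "HOL-Library.Countable"
begin

text \<open>
  The hard half is that the set of codes is \<open>\<Pi>\<^sup>1\<^sub>1(X)\<close>.  Entailment quantifies over arbitrary Turing ideals, but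
  by a Loewenheim-Skolem argument (\<open>countable_countermodel\<close>) a sentence that fails in some Turing ideal
  containing \<open>X\<close> fails in a countable one, which is coded by the columns of a single set \<open>Z\<close>.  So \<open>\<phi>\<close> is
  entailed iff no set \<open>Z\<close> codes a countermodel, and what remains is to say this arithmetically in \<open>Z\<close>.

  Truth in the coded model and computability from its columns are reached through further contents of
  \<open>Z\<close>: it also carries judgements on the values of programs, terms and formulas, and is required to be
  closed under the rules that generate the true judgements (\<open>saturated\<close>), which is a first order
  condition using arithmetic and pairing only.  A saturated set contains all true
  judgements about its columns, by \<open>computes_complete\<close> and \<open>sat_complete\<close>, and the set of true judgements is
  saturated itself (\<open>saturated_true_judgements\<close>).  The remaining condition states that the columns miss
  \<open>X\<close>, a join or a set computable from a column, or that a formula with the given code is judged true.  It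
  is positive in the judgements, so quantifying over all saturated sets amounts to evaluating it at
  the true ones.  The closure properties of \<open>arith_pred\<close> turn the description into a formula.

  Hardness is direct.  If \<open>A\<close> consists of the \<open>n\<close> with \<open>\<forall>Y. \<theta>(n, X, Y)\<close>, then \<open>n\<close> is mapped to the code of
  the sentence saying this of \<open>n\<close>.  As \<open>\<theta>\<close> is arithmetical, a true sentence of this form holds in every \<open>\<omega>\<close>-model containing \<open>X\<close>, and a false
  one fails in the full model, which is a Turing ideal.
\<close>

section \<open>Arithmetical predicates\<close>

abbreviation pair :: "nat \<Rightarrow> nat \<Rightarrow> nat" (infixr "\<star>" 75) where
  "a \<star> b \<equiv> prod_encode (a, b)"

definition ExN :: "nat \<Rightarrow> fm \<Rightarrow> fm" where
  "ExN i \<phi> = Neg (AllN i (Neg \<phi>))"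

lemma ExN_simps [simp]:
  "sat M C e E (ExN i \<phi>) \<longleftrightarrow> (\<exists>n. sat M C (e(i := n)) E \<phi>)"
  "arithmetical (ExN i \<phi>) = arithmetical \<phi>"
  "in_L2 (ExN i \<phi>) = in_L2 \<phi>"
  "free_nvars (ExN i \<phi>) = free_nvars \<phi> - {i}"
  "free_svars (ExN i \<phi>) = free_svars \<phi>"
  by (auto simp: ExN_def)

text \<open>Doubling both sides clears the division in the triangular numbers, so that the graph of the pairing
  function is given by an equation between polynomials.\<close>

definition pair_fm :: "nat \<Rightarrow> nat \<Rightarrow> nat \<Rightarrow> fm" where
  "pair_fm w a b = (let s = Plus (NVar a) (NVar b) in
     Eq (Plus (NVar w) (NVar w)) (Plus (Times s (Plus s NOne)) (Plus (NVar a) (NVar a))))"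

lemma double_triangle: "2 * triangle n = n * Suc n"
  by (simp add: triangle_def)

lemma pair_fm_simps [simp]:
  "sat M C e E (pair_fm w a b) \<longleftrightarrow> e w = e a \<star> e b"
  "arithmetical (pair_fm w a b)" "in_L2 (pair_fm w a b)"
  "free_nvars (pair_fm w a b) = {w, a, b}" "free_svars (pair_fm w a b) = {}"
proof -
  have "sat M C e E (pair_fm w a b) \<longleftrightarrow> 2 * e w = 2 * triangle (e a + e b) + 2 * e a"
    unfolding double_triangle by (simp add: pair_fm_def Let_def mult_2)
  also have "\<dots> \<longleftrightarrow> e w = e a \<star> e b"
    by (simp add: prod_encode_def) linarith
  finally show "sat M C e E (pair_fm w a b) \<longleftrightarrow> e w = e a \<star> e b" .
qed (auto simp: pair_fm_def Let_def)

text \<open>With fixed variables for the argument (1) and the value (2), defining formulas can be combined without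
  renaming.\<close>

definition arith_fun :: "(nat \<Rightarrow> nat) \<Rightarrow> bool" where
  "arith_fun g \<longleftrightarrow> (\<exists>\<gamma>. arithmetical \<gamma> \<and> in_L2 \<gamma> \<and> free_nvars \<gamma> \<subseteq> {1, 2} \<and> free_svars \<gamma> = {} \<and>
     (\<forall>M C e E. sat M C e E \<gamma> \<longleftrightarrow> e 2 = g (e 1)))"

text \<open>Set variable 1 is the parameter and set variable 2 the witness, over which the \<open>\<Pi>\<^sup>1\<^sub>1\<close> formula will
  quantify.  There is a single number argument: finite tuples of numbers are passed as nested pairs,
  so that any number of nested quantifiers can be handled with one fixed number variable.\<close>

definition arith_pred :: "(nat set \<Rightarrow> nat set \<Rightarrow> nat \<Rightarrow> bool) \<Rightarrow> bool" where
  "arith_pred P \<longleftrightarrow> (\<exists>\<phi>. arithmetical \<phi> \<and> in_L2 \<phi> \<and> free_nvars \<phi> \<subseteq> {1} \<and>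
     free_svars \<phi> \<subseteq> {1, 2} \<and> (\<forall>M C e E. sat M C e E \<phi> \<longleftrightarrow> P (E 1) (E 2) (e 1)))"

lemma arith_funI:
  assumes "arithmetical \<gamma>" "in_L2 \<gamma>" "free_nvars \<gamma> \<subseteq> {1, 2}" "free_svars \<gamma> = {}"
    and "\<And>M C e E. sat M C e E \<gamma> \<longleftrightarrow> e 2 = g (e 1)"
  shows "arith_fun g"
  using assms unfolding arith_fun_def by blast

lemma arith_predI:
  assumes "arithmetical \<phi>" "in_L2 \<phi>" "free_nvars \<phi> \<subseteq> {1}" "free_svars \<phi> \<subseteq> {1, 2}"
    and "\<And>M C e E. sat M C e E \<phi> \<longleftrightarrow> P (E 1) (E 2) (e 1)"
  shows "arith_pred P"
  using assms unfolding arith_pred_def by blast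

lemma arith_fun_id: "arith_fun (\<lambda>v. v)"
  by (rule arith_funI[of "Eq (NVar 2) (NVar 1)"]) auto

text \<open>The formulas for the two operands both report in variable 2, so their values are moved to the
  variables 3 and 4 before they are combined.\<close>

lemma arith_fun_binary:
  assumes f: "arith_fun f" and g: "arith_fun g"
    and \<beta>: "arithmetical \<beta>" "in_L2 \<beta>" "free_nvars \<beta> \<subseteq> {2, 3, 4}" "free_svars \<beta> = {}"
    "\<And>M C e E. sat M C e E \<beta> \<longleftrightarrow> e 2 = h (e 3) (e 4)"
  shows "arith_fun (\<lambda>v. h (f v) (g v))"
proof -
  obtain \<gamma> where \<gamma>: "arithmetical \<gamma>" "in_L2 \<gamma>" "free_nvars \<gamma> \<subseteq> {1, 2}" "free_svars \<gamma> = {}"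
    "\<And>M C e E. sat M C e E \<gamma> \<longleftrightarrow> e 2 = f (e 1)"
    using f unfolding arith_fun_def by blast
  obtain \<delta> where \<delta>: "arithmetical \<delta>" "in_L2 \<delta>" "free_nvars \<delta> \<subseteq> {1, 2}" "free_svars \<delta> = {}"
    "\<And>M C e E. sat M C e E \<delta> \<longleftrightarrow> e 2 = g (e 1)"
    using g unfolding arith_fun_def by blast
  let ?copy = "\<lambda>\<gamma> i. ExN 2 (Conj \<gamma> (Eq (NVar i) (NVar 2)))"
  show ?thesis
    by (rule arith_funI[of "ExN 3 (Conj (?copy \<gamma> 3) (ExN 4 (Conj (?copy \<delta> 4) \<beta>)))"])
      (use \<beta> \<gamma> \<delta> in auto)
qed

lemma arith_fun_plus: "arith_fun f \<Longrightarrow> arith_fun g \<Longrightarrow> arith_fun (\<lambda>v. f v + g v)"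
  by (rule arith_fun_binary[where \<beta> = "Eq (NVar 2) (Plus (NVar 3) (NVar 4))"]) auto

lemma arith_fun_times: "arith_fun f \<Longrightarrow> arith_fun g \<Longrightarrow> arith_fun (\<lambda>v. f v * g v)"
  by (rule arith_fun_binary[where \<beta> = "Eq (NVar 2) (Times (NVar 3) (NVar 4))"]) auto

lemma arith_fun_pair: "arith_fun f \<Longrightarrow> arith_fun g \<Longrightarrow> arith_fun (\<lambda>v. f v \<star> g v)"
  by (rule arith_fun_binary[where \<beta> = "pair_fm 2 3 4"]) auto

lemma arith_fun_Suc: "arith_fun f \<Longrightarrow> arith_fun (\<lambda>v. Suc (f v))"
  by (rule arith_fun_binary[where \<beta> = "Eq (NVar 2) (Plus (NVar 3) NOne)" and h = "\<lambda>a b. Suc a"]) auto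

lemma arith_fun_fst: "arith_fun f \<Longrightarrow> arith_fun (\<lambda>v. fst (prod_decode (f v)))"
  by (rule arith_fun_binary[where \<beta> = "ExN 5 (pair_fm 3 2 5)" and h = "\<lambda>a b. fst (prod_decode a)"])
    (auto, metis prod.collapse prod_decode_inverse)

lemma arith_fun_snd: "arith_fun f \<Longrightarrow> arith_fun (\<lambda>v. snd (prod_decode (f v)))"
  by (rule arith_fun_binary[where \<beta> = "ExN 5 (pair_fm 3 5 2)" and h = "\<lambda>a b. snd (prod_decode a)"])
    (auto, metis prod.collapse prod_decode_inverse)

lemma arith_fun_const: "arith_fun (\<lambda>v. c)"
proof (induction c)
  case 0
  show ?case by (rule arith_funI[of "Eq (NVar 2) NZero"]) auto
qed (rule arith_fun_Suc)

lemmas arith_fun_intros = arith_fun_id arith_fun_const arith_fun_Suc arith_fun_plus arith_fun_times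
  arith_fun_pair arith_fun_fst arith_fun_snd

lemma arith_pred_not: "arith_pred P \<Longrightarrow> arith_pred (\<lambda>X Z v. \<not> P X Z v)"
  unfolding arith_pred_def by (elim exE conjE, rule_tac x = "Neg \<phi>" in exI) auto

lemma arith_pred_conj:
  assumes "arith_pred P" "arith_pred Q"
  shows "arith_pred (\<lambda>X Z v. P X Z v \<and> Q X Z v)"
  using assms unfolding arith_pred_def by (elim exE conjE, rule_tac x = "Conj \<phi> \<phi>'" in exI) auto

lemma arith_pred_disj:
  assumes "arith_pred P" "arith_pred Q"
  shows "arith_pred (\<lambda>X Z v. P X Z v \<or> Q X Z v)"
  using arith_pred_not[OF arith_pred_conj[OF arith_pred_not[OF assms(1)] arith_pred_not[OF assms(2)]]]
  by simp

lemma arith_pred_imp: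
  assumes "arith_pred P" "arith_pred Q"
  shows "arith_pred (\<lambda>X Z v. P X Z v \<longrightarrow> Q X Z v)"
  using arith_pred_disj[OF arith_pred_not[OF assms(1)] assms(2)] by simp

lemma arith_pred_iff:
  assumes "arith_pred P" "arith_pred Q"
  shows "arith_pred (\<lambda>X Z v. P X Z v \<longleftrightarrow> Q X Z v)"
  using arith_pred_conj[OF arith_pred_imp[OF assms] arith_pred_imp[OF assms(2,1)]]
  by (simp only: iff_conv_conj_imp)

text \<open>A quantifier pushes its value onto the tuple of the values bound so far.  The argument form of
  the assumption lets higher order unification strip the quantifiers of a given predicate one by one,
  replacing each bound variable by a chain of projections.\<close>

lemma arith_pred_all:
  assumes "arith_pred (\<lambda>X Z v. P X Z (fst (prod_decode v)) (snd (prod_decode v)))"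
  shows "arith_pred (\<lambda>X Z v. \<forall>n. P X Z n v)"
proof -
  obtain \<phi> where \<phi>: "arithmetical \<phi>" "in_L2 \<phi>" "free_nvars \<phi> \<subseteq> {1}" "free_svars \<phi> \<subseteq> {1, 2}"
    "\<And>M C e E. sat M C e E \<phi> \<longleftrightarrow> P (E 1) (E 2) (fst (prod_decode (e 1))) (snd (prod_decode (e 1)))"
    using assms unfolding arith_pred_def by blast
  show ?thesis
    by (rule arith_predI[of "AllN 3 (ExN 2 (Conj (Eq (NVar 2) (NVar 1))
          (ExN 1 (Conj (pair_fm 1 3 2) \<phi>))))"]) (use \<phi> in auto)
qed

lemma arith_pred_ex:
  assumes "arith_pred (\<lambda>X Z v. P X Z (fst (prod_decode v)) (snd (prod_decode v)))"
  shows "arith_pred (\<lambda>X Z v. \<exists>n. P X Z n v)"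
  using arith_pred_not[OF arith_pred_all[OF arith_pred_not[OF assms]]] by simp

lemma arith_pred_subst:
  assumes "arith_pred P" "arith_fun g"
  shows "arith_pred (\<lambda>X Z v. P X Z (g v))"
proof -
  obtain \<phi> where \<phi>: "arithmetical \<phi>" "in_L2 \<phi>" "free_nvars \<phi> \<subseteq> {1}" "free_svars \<phi> \<subseteq> {1, 2}"
    "\<And>M C e E. sat M C e E \<phi> \<longleftrightarrow> P (E 1) (E 2) (e 1)"
    using assms(1) unfolding arith_pred_def by blast
  obtain \<gamma> where \<gamma>: "arithmetical \<gamma>" "in_L2 \<gamma>" "free_nvars \<gamma> \<subseteq> {1, 2}" "free_svars \<gamma> = {}"
    "\<And>M C e E. sat M C e E \<gamma> \<longleftrightarrow> e 2 = g (e 1)"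
    using assms(2) unfolding arith_fun_def by blast
  show ?thesis
    by (rule arith_predI[of "ExN 2 (Conj \<gamma> (ExN 1 (Conj (Eq (NVar 1) (NVar 2)) \<phi>)))"])
      (use \<phi> \<gamma> in auto)
qed

lemma arith_pred_mem:
  assumes "arith_fun g"
  shows arith_pred_mem_parameter: "arith_pred (\<lambda>X Z v. g v \<in> X)"
    and arith_pred_mem_witness: "arith_pred (\<lambda>X Z v. g v \<in> Z)"
proof -
  have "arith_pred (\<lambda>X Z v. v \<in> X)"
    by (rule arith_predI[of "Mem (NVar 1) (SVar 1)"]) auto
  then show "arith_pred (\<lambda>X Z v. g v \<in> X)" by (rule arith_pred_subst[OF _ assms])
  have "arith_pred (\<lambda>X Z v. v \<in> Z)"
    by (rule arith_predI[of "Mem (NVar 1) (SVar 2)"]) auto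
  then show "arith_pred (\<lambda>X Z v. g v \<in> Z)" by (rule arith_pred_subst[OF _ assms])
qed

lemma arith_pred_binary:
  assumes f: "arith_fun f" and g: "arith_fun g"
    and \<beta>: "arithmetical \<beta>" "in_L2 \<beta>" "free_nvars \<beta> \<subseteq> {2, 3}" "free_svars \<beta> = {}"
    "\<And>M C e E. sat M C e E \<beta> \<longleftrightarrow> R (e 2) (e 3)"
  shows "arith_pred (\<lambda>X Z v. R (f v) (g v))"
proof -
  obtain \<gamma> where \<gamma>: "arithmetical \<gamma>" "in_L2 \<gamma>" "free_nvars \<gamma> \<subseteq> {1, 2}" "free_svars \<gamma> = {}"
    "\<And>M C e E. sat M C e E \<gamma> \<longleftrightarrow> e 2 = f (e 1)"
    using f unfolding arith_fun_def by blast
  obtain \<delta> where \<delta>: "arithmetical \<delta>" "in_L2 \<delta>" "free_nvars \<delta> \<subseteq> {1, 2}" "free_svars \<delta> = {}"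
    "\<And>M C e E. sat M C e E \<delta> \<longleftrightarrow> e 2 = g (e 1)"
    using g unfolding arith_fun_def by blast
  show ?thesis
    by (rule arith_predI[of "ExN 3 (Conj (ExN 2 (Conj \<delta> (Eq (NVar 3) (NVar 2))))
          (ExN 2 (Conj \<gamma> \<beta>)))"]) (use \<beta> \<gamma> \<delta> in auto)
qed

lemma arith_pred_eq: "arith_fun f \<Longrightarrow> arith_fun g \<Longrightarrow> arith_pred (\<lambda>X Z v. f v = g v)"
  by (rule arith_pred_binary[where \<beta> = "Eq (NVar 2) (NVar 3)"]) auto

lemma arith_pred_less: "arith_fun f \<Longrightarrow> arith_fun g \<Longrightarrow> arith_pred (\<lambda>X Z v. f v < g v)"
  by (rule arith_pred_binary[where \<beta> = "Less (NVar 2) (NVar 3)"]) auto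

lemmas arith_intros = arith_fun_intros arith_pred_not arith_pred_conj arith_pred_disj arith_pred_imp
  arith_pred_iff arith_pred_all arith_pred_ex arith_pred_mem arith_pred_eq arith_pred_less

lemma Pi11_of_arith_pred:
  assumes "arith_pred P"
  shows "{n. \<forall>Z. P X Z n} \<in> Pi11 X"
proof -
  obtain \<phi> where \<phi>: "arithmetical \<phi>" "in_L2 \<phi>" "free_nvars \<phi> \<subseteq> {1}" "free_svars \<phi> \<subseteq> {1, 2}"
    "\<And>M C e E. sat M C e E \<phi> \<longleftrightarrow> P (E 1) (E 2) (e 1)"
    using assms unfolding arith_pred_def by blast
  show ?thesis
    unfolding Pi11_def by (rule CollectI, rule exI[of _ "AllS 2 \<phi>"]) (use \<phi> in \<open>auto simp: Pi11_formula_def\<close>)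
qed

section \<open>Programs\<close>

lemma computes_Comp1:
  "computes A q xs y \<Longrightarrow> computes A p [y] z \<Longrightarrow> computes A (Comp p [q]) xs z"
  by (rule computes.intros(5)[where ys = "[y]"]) auto

lemma computes_Comp2:
  "computes A q xs y \<Longrightarrow> computes A r xs y' \<Longrightarrow> computes A p [y, y'] z \<Longrightarrow> computes A (Comp p [q, r]) xs z"
  by (rule computes.intros(5)[where ys = "[y, y']"]) auto

lemma computes_Proj: "i < length xs \<Longrightarrow> xs ! i = y \<Longrightarrow> computes A (Proj i) xs y"
  using computes.intros(3) by metis

primrec const_prog :: "nat \<Rightarrow> prog" where
  "const_prog 0 = Zero"
| "const_prog (Suc c) = Comp Succ [const_prog c]"

lemma computes_const: "computes A (const_prog c) xs c"
  by (induction c) (auto intro: computes.intros computes_Comp1)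

definition add_prog :: prog where
  "add_prog = Prim (Proj 0) (Comp Succ [Proj 1])"

lemma computes_add: "computes A add_prog [m, n] (m + n)"
  unfolding add_prog_def
  by (induction m) (auto intro!: computes.intros(2,6,7) computes_Comp1 computes_Proj)

definition triangle_prog :: prog where
  "triangle_prog = Prim Zero (Comp add_prog [Proj 1, Comp Succ [Proj 0]])"

lemma computes_triangle: "computes A triangle_prog [n] (triangle n)"
  unfolding triangle_prog_def
proof (induction n)
  case (Suc n)
  have "computes A (Comp add_prog [Proj 1, Comp Succ [Proj 0]]) [n, triangle n] (triangle n + Suc n)"
    by (rule computes_Comp2[OF _ _ computes_add])
      (auto intro!: computes.intros(2) computes_Comp1 computes_Proj)
  with Suc show ?case by (auto intro: computes.intros)
qed (auto intro: computes.intros)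

definition pair_prog :: prog where
  "pair_prog = Comp add_prog [Comp triangle_prog [add_prog], Proj 0]"

lemma computes_pair: "computes A pair_prog [m, n] (m \<star> n)"
  unfolding pair_prog_def prod_encode_def
  by (auto intro!: computes_Comp2 computes_Comp1 computes_triangle computes_add computes_Proj)

lemma recursive_fun_const: "recursive_fun (\<lambda>x. c)"
  unfolding recursive_fun_def computable_in_def using computes_const by blast

lemma recursive_fun_pair:
  assumes "recursive_fun f" "recursive_fun g"
  shows "recursive_fun (\<lambda>x. f x \<star> g x)"
  using assms computes_Comp2[OF _ _ computes_pair]
  unfolding recursive_fun_def computable_in_def by blast

lemma recursive_fun_comp:
  assumes "recursive_fun f" "recursive_fun g"
  shows "recursive_fun (\<lambda>x. f (g x))"
  using assms computes_Comp1 unfolding recursive_fun_def computable_in_def by blast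

lemma recursive_fun_iterate:
  assumes "recursive_fun h"
  shows "recursive_fun (\<lambda>n. (h ^^ n) c)"
proof -
  obtain p where p: "\<And>x. computes {} p [x] (h x)"
    using assms unfolding recursive_fun_def computable_in_def by blast
  have "computes {} (Prim (const_prog c) (Comp p [Proj 1])) [n] ((h ^^ n) c)" for n
  proof (induction n)
    case (Suc n)
    have "computes {} (Comp p [Proj 1]) [n, (h ^^ n) c] (h ((h ^^ n) c))"
      by (rule computes_Comp1[OF _ p]) (auto intro: computes_Proj)
    with Suc show ?case by (auto intro: computes.intros)
  qed (auto intro: computes.intros computes_const)
  then show ?thesis unfolding recursive_fun_def computable_in_def by blast
qed

inductive_cases computes_ZeroE [elim!]: "computes A Zero xs y"
inductive_cases computes_SuccE [elim!]: "computes A Succ xs y"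
inductive_cases computes_ProjE [elim!]: "computes A (Proj i) xs y"
inductive_cases computes_OracleE [elim!]: "computes A Oracle xs y"
inductive_cases computes_CompE: "computes A (Comp p qs) xs y"
inductive_cases computes_Prim_0E: "computes A (Prim p q) (0 # xs) y"
inductive_cases computes_Prim_SucE: "computes A (Prim p q) (Suc n # xs) y"
inductive_cases computes_MinimE: "computes A (Minim p) xs y"

lemma list_all2_functional:
  "list_all2 (\<lambda>q y. \<forall>z. R q z \<longrightarrow> y = z) qs ys \<Longrightarrow> list_all2 R qs zs \<Longrightarrow> ys = zs"
proof (induction qs ys arbitrary: zs rule: list_all2_induct)
  case (Cons q qs y ys)
  then show ?case by (cases zs) auto
qed simp

text \<open>Induction on the computation.  The step for minimisation compares two candidate values: at the
  smaller one, the body would be both zero and positive.\<close>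

lemma computes_functional: "computes A p xs y \<Longrightarrow> computes A p xs z \<Longrightarrow> y = z"
proof -
  have "computes A p xs y \<Longrightarrow> \<forall>z. computes A p xs z \<longrightarrow> y = z"
  proof (induction rule: computes.induct)
    case (5 xs qs ys p z)
    have fns: "list_all2 (\<lambda>q y. \<forall>z. computes A q xs z \<longrightarrow> y = z) qs ys"
      by (rule list_all2_mono[OF 5(1)]) simp
    show ?case
    proof (intro allI impI)
      fix w assume "computes A (Comp p qs) xs w"
      then obtain zs where zs: "list_all2 (\<lambda>q y. computes A q xs y) qs zs" "computes A p zs w"
        by (rule computes_CompE)
      have "ys = zs" by (rule list_all2_functional[OF fns zs(1)])
      with zs(2) 5 show "z = w" by simp
    qed
  next
    case (6 p xs y q)
    then show ?case by (blast elim: computes_Prim_0E)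
  next
    case (7 p q n xs y z)
    then show ?case by (blast elim: computes_Prim_SucE)
  next
    case (8 p n xs)
    show ?case
    proof (intro allI impI, elim computes_MinimE)
      fix m assume m: "computes A p (m # xs) 0" "\<forall>k<m. \<exists>y. computes A p (k # xs) (Suc y)"
      have "\<not> n < m" using 8(2) m(2) by fastforce
      moreover have "\<not> m < n" using 8(3) m(1) by fastforce
      ultimately show "n = m" by simp
    qed
  qed auto
  then show "computes A p xs y \<Longrightarrow> computes A p xs z \<Longrightarrow> y = z" by blast
qed

section \<open>Satisfaction and free variables\<close>

lemma nval_cong: "(\<And>i. i \<in> tm_nvars t \<Longrightarrow> e i = e' i) \<Longrightarrow> nval e t = nval e' t"
  by (induction t) auto

lemma sval_cong: "(\<And>i. i \<in> tm_svars S \<Longrightarrow> E i = E' i) \<Longrightarrow> sval X E S = sval X E' S"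
  by (cases S) auto

lemma sat_cong:
  assumes "\<And>i. i \<in> free_nvars \<phi> \<Longrightarrow> e i = e' i" "\<And>i. i \<in> free_svars \<phi> \<Longrightarrow> E i = E' i"
  shows "sat M X e E \<phi> \<longleftrightarrow> sat M X e' E' \<phi>"
  using assms
proof (induction \<phi> arbitrary: e e' E E')
  case (Eq s t)
  then show ?case using nval_cong[of s e e'] nval_cong[of t e e'] by simp
next
  case (Less s t)
  then show ?case using nval_cong[of s e e'] nval_cong[of t e e'] by simp
next
  case (Mem t S)
  have "nval e t = nval e' t" "sval X E S = sval X E' S"
    using Mem.prems by (simp_all add: nval_cong[of t e e'] sval_cong[of S E E'])
  then show ?case by simp
next
  case (Neg \<phi>)
  have "sat M X e E \<phi> \<longleftrightarrow> sat M X e' E' \<phi>" by (rule Neg.IH) (use Neg.prems in auto)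
  then show ?case by simp
next
  case (Conj \<phi> \<psi>)
  have "sat M X e E \<phi> \<longleftrightarrow> sat M X e' E' \<phi>" by (rule Conj.IH(1)) (use Conj.prems in auto)
  moreover have "sat M X e E \<psi> \<longleftrightarrow> sat M X e' E' \<psi>" by (rule Conj.IH(2)) (use Conj.prems in auto)
  ultimately show ?case by simp
next
  case (AllN i \<phi>)
  have "sat M X (e(i := n)) E \<phi> \<longleftrightarrow> sat M X (e'(i := n)) E' \<phi>" for n
    by (rule AllN.IH) (use AllN.prems in auto)
  then show ?case by simp
next
  case (AllS i \<phi>)
  have "sat M X e (E(i := Y)) \<phi> \<longleftrightarrow> sat M X e' (E'(i := Y)) \<phi>" for Y
    by (rule AllS.IH) (use AllS.prems in auto)
  then show ?case by simp
qed

lemma sat_sentence: "sentence \<phi> \<Longrightarrow> sat M X e E \<phi> \<longleftrightarrow> sat M X e' E' \<phi>"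
  by (rule sat_cong) (auto simp: sentence_def)

section \<open>Reduction of a \<open>\<Pi>\<^sup>1\<^sub>1(X)\<close> set to computable entailment\<close>

lemma sat_arithmetical: "arithmetical \<phi> \<Longrightarrow> sat M X e E \<phi> \<longleftrightarrow> sat M' X e E \<phi>"
  by (induction \<phi> arbitrary: e E) auto

text \<open>Bound variables are not respected.  The function is applied to arithmetical formulas, which bind no
  set variable.\<close>

fun subst_set :: "nat \<Rightarrow> set_term \<Rightarrow> fm \<Rightarrow> fm" where
  "subst_set i T (Mem t S) = Mem t (if S = SVar i then T else S)"
| "subst_set i T (Neg \<phi>) = Neg (subst_set i T \<phi>)"
| "subst_set i T (Conj \<phi> \<psi>) = Conj (subst_set i T \<phi>) (subst_set i T \<psi>)"
| "subst_set i T (AllN j \<phi>) = AllN j (subst_set i T \<phi>)"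
| "subst_set i T (AllS j \<phi>) = AllS j (subst_set i T \<phi>)"
| "subst_set i T \<phi> = \<phi>"

lemma arithmetical_subst_set: "arithmetical (subst_set i T \<phi>) \<longleftrightarrow> arithmetical \<phi>"
  by (induction \<phi>) auto

lemma sat_subst_set:
  "arithmetical \<phi> \<Longrightarrow> in_L2 \<phi> \<Longrightarrow>
    sat M X e E (subst_set i SConst \<phi>) \<longleftrightarrow> sat M' C e (E(i := X)) \<phi>"
proof (induction \<phi> arbitrary: e)
  case (Mem t S)
  then show ?case by (cases S) auto
qed auto

lemma free_subst_set:
  "free_nvars (subst_set i SConst \<phi>) = free_nvars \<phi>"
  "arithmetical \<phi> \<Longrightarrow> free_svars (subst_set i SConst \<phi>) = free_svars \<phi> - {i}"
proof (induction \<phi>)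
  case (Mem t S) { case 2 then show ?case by (cases S) auto } qed auto

primrec numeral_tm :: "nat \<Rightarrow> num_term" where
  "numeral_tm 0 = NZero"
| "numeral_tm (Suc n) = Plus (numeral_tm n) NOne"

lemma numeral_tm_simps [simp]: "nval e (numeral_tm n) = n" "tm_nvars (numeral_tm n) = {}"
  by (induction n) auto

lemma recursive_numeral_index: "recursive_fun (\<lambda>n. num_term_index (numeral_tm n))"
proof -
  have "num_term_index (numeral_tm n) =
      ((\<lambda>t. 3 \<star> t \<star> num_term_index NOne) ^^ n) (num_term_index NZero)" for n
    by (induction n) auto
  moreover have "recursive_fun (\<lambda>t. t)"
    unfolding recursive_fun_def computable_in_def by (rule exI[of _ "Proj 0"]) (auto intro: computes_Proj)
  ultimately show ?thesis
    by (simp only:) (intro recursive_fun_iterate recursive_fun_pair recursive_fun_const)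
qed

lemma turing_ideal_UNIV: "turing_ideal UNIV"
  by (simp add: turing_ideal_def)

text \<open>The numeral is brought in by a guarded quantifier instead of a substitution into \<open>\<theta>\<close>: the index of
  the instance then arises from the index of the numeral by pairing with constants, which makes it a
  recursive function of \<open>n\<close>.\<close>

definition instance_fm :: "nat \<Rightarrow> fm \<Rightarrow> nat \<Rightarrow> fm" where
  "instance_fm i \<theta> n = AllS i (AllN 1 (Neg (Conj (Eq (NVar 1) (numeral_tm n)) (Neg \<theta>))))"

lemma recursive_instance_index: "recursive_fun (\<lambda>n. fm_index (instance_fm i \<theta> n))"
  unfolding instance_fm_def fm_index.simps
  by (intro recursive_fun_pair recursive_fun_const recursive_numeral_index)

text \<open>The matrix is arithmetical, so its truth does not depend on the model and the instance asserts
  less in a smaller model.  Hence the full model, which is a Turing ideal, decides entailment.\<close>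

lemma comp_entailed_instance_fm:
  assumes "arithmetical \<theta>" "sentence (instance_fm i \<theta> n)"
  shows "comp_entailed X (instance_fm i \<theta> n) \<longleftrightarrow>
    (\<forall>Y. sat UNIV X ((\<lambda>_. 0)(1 := n)) ((\<lambda>_. {})(i := Y)) \<theta>)" (is "_ \<longleftrightarrow> ?R")
proof -
  have sat: "sat M X e E (instance_fm i \<theta> n) \<longleftrightarrow>
      (\<forall>Y\<in>M. sat UNIV X ((\<lambda>_. 0)(1 := n)) ((\<lambda>_. {})(i := Y)) \<theta>)" for M e E
  proof -
    have "sat M X e E (instance_fm i \<theta> n) \<longleftrightarrow> sat M X (\<lambda>_. 0) (\<lambda>_. {}) (instance_fm i \<theta> n)"
      by (rule sat_sentence[OF assms(2)])
    also have "\<dots> \<longleftrightarrow> (\<forall>Y\<in>M. sat M X ((\<lambda>_. 0)(1 := n)) ((\<lambda>_. {})(i := Y)) \<theta>)"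
      by (auto simp: instance_fm_def)
    finally show ?thesis using sat_arithmetical[OF assms(1)] by blast
  qed
  show ?thesis
    unfolding comp_entailed_def models_def sat using turing_ideal_UNIV by blast
qed

lemma sentence_mem_comp_entailment:
  assumes "goedel_coding code" "sentence \<phi>"
  shows "code \<phi> \<in> comp_entailment code X \<longleftrightarrow> comp_entailed X \<phi>"
  using assms unfolding comp_entailment_def goedel_coding_def bij_betw_def inj_on_def by blast

lemma numeral_tm_inject: "numeral_tm m = numeral_tm n \<longleftrightarrow> m = n"
  by (metis numeral_tm_simps(1))

text \<open>The set constant replaces the parameter variable, which turns the given formula into a matrix whose
  instances are sentences.\<close>

lemma Pi11_instances:
  assumes "A \<in> Pi11 X"
  obtains i \<theta> where "arithmetical \<theta>" "\<And>n. sentence (instance_fm i \<theta> n)"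
    "\<And>n. n \<in> A \<longleftrightarrow> (\<forall>Y. sat UNIV X ((\<lambda>_. 0)(1 := n)) ((\<lambda>_. {})(i := Y)) \<theta>)"
proof -
  obtain i \<theta> where \<theta>: "arithmetical \<theta>" "in_L2 \<theta>" "free_nvars \<theta> \<subseteq> {1}" "free_svars \<theta> \<subseteq> {1, i}"
    and A: "A = {n. \<forall>Y. sat UNIV {} ((\<lambda>_. 0)(1 := n)) ((\<lambda>_. {})(1 := X, i := Y)) \<theta>}"
    using assms unfolding Pi11_def Pi11_formula_def by fastforce
  show thesis
  proof (cases "i = 1")
    case True
    \<comment> \<open>The set quantifier binds variable 1 here.  Variable 0 is not free, so that replacing it leaves
      an equivalent matrix.\<close>
    show thesis
    proof
      show "sentence (instance_fm i (subst_set 0 SConst \<theta>) n)" for n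
        using \<theta> True by (auto simp: instance_fm_def sentence_def free_subst_set)
      show "arithmetical (subst_set 0 SConst \<theta>)" by (simp add: arithmetical_subst_set \<theta>(1))
      show "n \<in> A \<longleftrightarrow> (\<forall>Y. sat UNIV X ((\<lambda>_. 0)(1 := n)) ((\<lambda>_. {})(i := Y)) (subst_set 0 SConst \<theta>))" for n
      proof -
        have "sat UNIV {} ((\<lambda>_. 0)(1 := n)) ((\<lambda>_. {})(1 := X, i := Y)) \<theta> \<longleftrightarrow>
            sat UNIV {} ((\<lambda>_. 0)(1 := n)) ((\<lambda>_. {})(i := Y, 0 := X)) \<theta>" for Y
          by (rule sat_cong) (use True \<theta> in auto)
        then show ?thesis
          unfolding A sat_subst_set[OF \<theta>(1,2), of UNIV X _ _ 0 UNIV "{}"] by blast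
      qed
    qed
  next
    case False
    show thesis
    proof
      show "sentence (instance_fm i (subst_set 1 SConst \<theta>) n)" for n
        using \<theta> by (auto simp: instance_fm_def sentence_def free_subst_set)
      show "arithmetical (subst_set 1 SConst \<theta>)" by (simp add: arithmetical_subst_set \<theta>(1))
      show "n \<in> A \<longleftrightarrow> (\<forall>Y. sat UNIV X ((\<lambda>_. 0)(1 := n)) ((\<lambda>_. {})(i := Y)) (subst_set 1 SConst \<theta>))" for n
        unfolding A sat_subst_set[OF \<theta>(1,2), of UNIV X _ _ 1 UNIV "{}"]
        using False by (simp add: fun_upd_twist)
    qed
  qed
qed

lemma one_le_comp_entailment:
  assumes "goedel_coding code" and "A \<in> Pi11 X"
  shows "A \<le>\<^sub>1 comp_entailment code X"
proof -
  obtain \<theta> i where \<theta>: "arithmetical \<theta>" "\<And>n. sentence (instance_fm i \<theta> n)"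
    "\<And>n. n \<in> A \<longleftrightarrow> (\<forall>Y. sat UNIV X ((\<lambda>_. 0)(1 := n)) ((\<lambda>_. {})(i := Y)) \<theta>)"
    by (rule Pi11_instances[OF assms(2)]) (rule that)
  obtain f where f: "recursive_fun f" "\<And>\<phi>. sentence \<phi> \<Longrightarrow> code \<phi> = f (fm_index \<phi>)"
    using assms(1) unfolding goedel_coding_def by blast
  have "recursive_fun (\<lambda>n. code (instance_fm i \<theta> n))"
    unfolding f(2)[OF \<theta>(2)] by (rule recursive_fun_comp[OF f(1) recursive_instance_index])
  moreover have "inj (\<lambda>n. code (instance_fm i \<theta> n))"
  proof (rule injI)
    fix m n assume "code (instance_fm i \<theta> m) = code (instance_fm i \<theta> n)"
    then have "instance_fm i \<theta> m = instance_fm i \<theta> n"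
      using assms(1) \<theta>(2) unfolding goedel_coding_def bij_betw_def inj_on_def by blast
    then show "m = n" by (simp add: instance_fm_def numeral_tm_inject)
  qed
  moreover have "n \<in> A \<longleftrightarrow> code (instance_fm i \<theta> n) \<in> comp_entailment code X" for n
    unfolding sentence_mem_comp_entailment[OF assms(1) \<theta>(2)] \<theta>(3)
    using comp_entailed_instance_fm[OF \<theta>(1,2)] by blast
  ultimately show ?thesis unfolding one_le_def by blast
qed

section \<open>Numerical codes of programs and environments\<close>

text \<open>The number 1 serves as a tag in codes, where it should look like the other tags.\<close>

declare One_nat_def [simp del]

fun prog_index :: "prog \<Rightarrow> nat" where
  "prog_index Zero = 0 \<star> 0"
| "prog_index Succ = 1 \<star> 0"
| "prog_index (Proj i) = 2 \<star> i"
| "prog_index Oracle = 3 \<star> 0"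
| "prog_index (Comp p qs) = 4 \<star> prog_index p \<star> list_encode (map prog_index qs)"
| "prog_index (Prim p q) = 5 \<star> prog_index p \<star> prog_index q"
| "prog_index (Minim p) = 6 \<star> prog_index p"

lemma snd_prod_decode_less:
  assumes "fst (prod_decode n) \<noteq> 0"
  shows "snd (prod_decode n) < n"
proof -
  define t r where "t = fst (prod_decode n)" and "r = snd (prod_decode n)"
  have "m \<le> triangle m" for m by (induction m) auto
  then have "t + r \<le> triangle (t + r)" .
  moreover have "n = triangle (t + r) + t"
    using prod_decode_inverse[of n] by (simp add: prod_encode_def case_prod_unfold t_def r_def)
  moreover have "0 < t" using assms by (simp add: t_def)
  ultimately show ?thesis unfolding r_def[symmetric] by linarith
qed

lemma prod_decode_le: "fst (prod_decode n) \<le> n" "snd (prod_decode n) \<le> n"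
  using le_prod_encode_1[of "fst (prod_decode n)" "snd (prod_decode n)"]
    le_prod_encode_2[of "snd (prod_decode n)" "fst (prod_decode n)"] by simp_all

lemma mem_list_decode_less: "x \<in> set (list_decode l) \<Longrightarrow> x < l"
proof -
  have "x \<in> set xs \<Longrightarrow> x < list_encode xs" for xs
  proof (induction xs)
    case (Cons y xs)
    then show ?case
      using le_prod_encode_1[of y "list_encode xs"] le_prod_encode_2[of "list_encode xs" y] by auto
  qed simp
  from this[of "list_decode l"] show "x \<in> set (list_decode l) \<Longrightarrow> x < l" by simp
qed

text \<open>A total decoding that commutes with all constructors: every number of the form \<open>5 \<star> p \<star> q\<close> codes a
  primitive recursion.  This is what makes the rule for a primitive recursion at 0 sound, since that
  rule mentions the code \<open>q\<close> of a step program about which no premise says anything.\<close>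

function prog_of :: "nat \<Rightarrow> prog" where
  "prog_of n =
    (if fst (prod_decode n) = 0 then Zero
     else if fst (prod_decode n) = 1 then Succ
     else if fst (prod_decode n) = 2 then Proj (snd (prod_decode n))
     else if fst (prod_decode n) = 3 then Oracle
     else if fst (prod_decode n) = 4 then
       Comp (prog_of (fst (prod_decode (snd (prod_decode n)))))
         (map prog_of (list_decode (snd (prod_decode (snd (prod_decode n))))))
     else if fst (prod_decode n) = 5 then
       Prim (prog_of (fst (prod_decode (snd (prod_decode n)))))
         (prog_of (snd (prod_decode (snd (prod_decode n)))))
     else Minim (prog_of (snd (prod_decode n))))"
  by pat_completeness auto
termination
proof (relation "measure id", goal_cases)
  case (2 n)
  with snd_prod_decode_less[of n] prod_decode_le[of "snd (prod_decode n)"] show ?case by simp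
next
  case (3 n x)
  with snd_prod_decode_less[of n] prod_decode_le[of "snd (prod_decode n)"] mem_list_decode_less[of x]
  show ?case by fastforce
next
  case (4 n)
  with snd_prod_decode_less[of n] prod_decode_le[of "snd (prod_decode n)"] show ?case by simp
next
  case (5 n)
  with snd_prod_decode_less[of n] prod_decode_le[of "snd (prod_decode n)"] show ?case by simp
next
  case (6 n)
  with snd_prod_decode_less[of n] show ?case by simp
qed simp

declare prog_of.simps [simp del]

lemma prog_of_simps [simp]:
  "prog_of (0 \<star> r) = Zero" "prog_of (1 \<star> r) = Succ" "prog_of (2 \<star> i) = Proj i"
  "prog_of (3 \<star> r) = Oracle" "prog_of (4 \<star> p \<star> qs) = Comp (prog_of p) (map prog_of (list_decode qs))"
  "prog_of (5 \<star> p \<star> q) = Prim (prog_of p) (prog_of q)" "prog_of (6 \<star> p) = Minim (prog_of p)"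
  by (subst prog_of.simps; simp)+

lemma prog_of_prog_index: "prog_of (prog_index p) = p"
  by (induction p) (auto intro: map_idI)

lemma num_term_index_inject: "num_term_index s = num_term_index t \<longleftrightarrow> s = t"
proof
  show "num_term_index s = num_term_index t \<Longrightarrow> s = t"
    by (induction s arbitrary: t) (case_tac t; auto)+
qed simp

lemma set_term_index_inject: "set_term_index S = set_term_index T \<longleftrightarrow> S = T"
  by (cases S; cases T) auto

lemma fm_index_inject: "fm_index \<phi> = fm_index \<psi> \<longleftrightarrow> \<phi> = \<psi>"
proof
  show "fm_index \<phi> = fm_index \<psi> \<Longrightarrow> \<phi> = \<psi>"
    by (induction \<phi> arbitrary: \<psi>)
      (case_tac \<psi>; auto simp: num_term_index_inject set_term_index_inject)+
qed simp

abbreviation cons_code :: "nat \<Rightarrow> nat \<Rightarrow> nat" (infixr "\<rhd>" 74) where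
  "x \<rhd> l \<equiv> Suc (x \<star> l)"

text \<open>Environments are association lists, in which the first entry for a variable counts.  Updating an
  environment is then a single pairing operation.\<close>

definition assoc_encode :: "(nat \<times> nat) list \<Rightarrow> nat" where
  "assoc_encode L = list_encode (map prod_encode L)"

definition assoc_decode :: "nat \<Rightarrow> (nat \<times> nat) list" where
  "assoc_decode l = map prod_decode (list_decode l)"

lemma assoc_simps [simp]:
  "assoc_decode 0 = []" "assoc_decode ((i \<star> a) \<rhd> l) = (i, a) # assoc_decode l"
  "assoc_encode [] = 0" "assoc_encode ((i, a) # L) = (i \<star> a) \<rhd> assoc_encode L"
  by (simp_all add: assoc_encode_def assoc_decode_def)

fun env :: "'a \<Rightarrow> (nat \<times> 'a) list \<Rightarrow> nat \<Rightarrow> 'a" where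
  "env d [] = (\<lambda>_. d)"
| "env d ((i, a) # L) = (env d L)(i := a)"

text \<open>The set \<open>Z\<close> codes a countable \<open>\<omega>\<close>-model by its columns, next to judgements about this model, which are
  distinguished from the model by the leading tag.\<close>

definition col :: "nat set \<Rightarrow> nat \<Rightarrow> nat set" where
  "col Z i = {x. 0 \<star> i \<star> x \<in> Z}"

section \<open>Sets of judgements closed under the evaluation rules\<close>

text \<open>The judgements read: program \<open>p\<close> with column \<open>i\<close> as oracle computes \<open>y\<close> from the arguments \<open>xs\<close>; the
  programs \<open>qs\<close> compute the values \<open>ys\<close>; the term \<open>t\<close> has the value \<open>a\<close> in \<open>e\<close>; the truth value of \<open>x\<close> being in
  the set term \<open>S\<close> is \<open>b\<close>; the truth value of the formula \<open>k\<close> is \<open>b\<close>.  A set environment assigns column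
  numbers to the set variables.  Truth values are explicit because all rules below are then positive
  in the judgements.\<close>

abbreviation "comp_j Z i p xs y \<equiv> 1 \<star> i \<star> p \<star> xs \<star> y \<in> Z"
abbreviation "comps_j Z i qs xs ys \<equiv> 2 \<star> i \<star> qs \<star> xs \<star> ys \<in> Z"
abbreviation "val_j Z t e a \<equiv> 3 \<star> t \<star> e \<star> a \<in> Z"
abbreviation "mem_j Z S E x b \<equiv> 4 \<star> S \<star> E \<star> x \<star> b \<in> Z"
abbreviation "sat_j Z k e E b \<equiv> 5 \<star> k \<star> e \<star> E \<star> b \<in> Z"

text \<open>Closure under the rules of evaluation.  Each rule is a first order condition on \<open>Z\<close>, and together they
  force \<open>Z\<close> to contain every true judgement about its columns.  Further judgements may be present, even
  false ones.  An environment supplies a value only for the variables that it lists, so the rules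
  give a formula a truth value only where its free variables are listed; in the empty environments these are
  the sentences.\<close>

locale saturated =
  fixes X Z :: "nat set"
  assumes comp_Zero: "\<And>i xs. comp_j Z i (0 \<star> 0) xs 0"
    and comp_Succ: "\<And>i x xs. comp_j Z i (1 \<star> 0) (x \<rhd> xs) (Suc x)"
    and comp_Proj_0: "\<And>i x xs. comp_j Z i (2 \<star> 0) (x \<rhd> xs) x"
    and comp_Proj_Suc: "\<And>i j x xs y. comp_j Z i (2 \<star> j) xs y \<Longrightarrow> comp_j Z i (2 \<star> Suc j) (x \<rhd> xs) y"
    and comp_Oracle_yes: "\<And>i x xs. 0 \<star> i \<star> x \<in> Z \<Longrightarrow> comp_j Z i (3 \<star> 0) (x \<rhd> xs) 1"
    and comp_Oracle_no: "\<And>i x xs. \<not> 0 \<star> i \<star> x \<in> Z \<Longrightarrow> comp_j Z i (3 \<star> 0) (x \<rhd> xs) 0"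
    and comp_Nil: "\<And>i xs. comps_j Z i 0 xs 0"
    and comp_Cons: "\<And>i q y qs xs ys. comp_j Z i q xs y \<Longrightarrow> comps_j Z i qs xs ys \<Longrightarrow>
      comps_j Z i (q \<rhd> qs) xs (y \<rhd> ys)"
    and comp_Comp: "\<And>i p qs xs ys z. comps_j Z i qs xs ys \<Longrightarrow> comp_j Z i p ys z \<Longrightarrow>
      comp_j Z i (4 \<star> p \<star> qs) xs z"
    and comp_Prim_0: "\<And>i p q xs y. comp_j Z i p xs y \<Longrightarrow> comp_j Z i (5 \<star> p \<star> q) (0 \<rhd> xs) y"
    and comp_Prim_Suc: "\<And>i p q n xs y z. comp_j Z i (5 \<star> p \<star> q) (n \<rhd> xs) y \<Longrightarrow>
      comp_j Z i q (n \<rhd> y \<rhd> xs) z \<Longrightarrow> comp_j Z i (5 \<star> p \<star> q) (Suc n \<rhd> xs) z"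
    and comp_Minim: "\<And>i p n xs. comp_j Z i p (n \<rhd> xs) 0 \<Longrightarrow>
      \<forall>m. m < n \<longrightarrow> (\<exists>y. comp_j Z i p (m \<rhd> xs) (Suc y)) \<Longrightarrow> comp_j Z i (6 \<star> p) xs n"
  assumes val_NVar_here: "\<And>j a e. val_j Z (0 \<star> j) ((j \<star> a) \<rhd> e) a"
    and val_NVar_there: "\<And>j l a b e. j \<noteq> l \<Longrightarrow> val_j Z (0 \<star> j) e a \<Longrightarrow> val_j Z (0 \<star> j) ((l \<star> b) \<rhd> e) a"
    and val_NZero: "\<And>e. val_j Z (1 \<star> 0) e 0"
    and val_NOne: "\<And>e. val_j Z (2 \<star> 0) e 1"
    and val_Plus: "\<And>s t e a b. val_j Z s e a \<Longrightarrow> val_j Z t e b \<Longrightarrow> val_j Z (3 \<star> s \<star> t) e (a + b)"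
    and val_Times: "\<And>s t e a b. val_j Z s e a \<Longrightarrow> val_j Z t e b \<Longrightarrow> val_j Z (4 \<star> s \<star> t) e (a * b)"
  assumes mem_SVar_yes: "\<And>j c E x. 0 \<star> c \<star> x \<in> Z \<Longrightarrow> mem_j Z (0 \<star> j) ((j \<star> c) \<rhd> E) x 1"
    and mem_SVar_no: "\<And>j c E x. \<not> 0 \<star> c \<star> x \<in> Z \<Longrightarrow> mem_j Z (0 \<star> j) ((j \<star> c) \<rhd> E) x 0"
    and mem_SVar_there: "\<And>j l c E x b. j \<noteq> l \<Longrightarrow> mem_j Z (0 \<star> j) E x b \<Longrightarrow>
      mem_j Z (0 \<star> j) ((l \<star> c) \<rhd> E) x b"
    and mem_SConst_yes: "\<And>E x. x \<in> X \<Longrightarrow> mem_j Z (1 \<star> 0) E x 1"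
    and mem_SConst_no: "\<And>E x. \<not> x \<in> X \<Longrightarrow> mem_j Z (1 \<star> 0) E x 0"
  assumes sat_Eq_yes: "\<And>s t e E a. val_j Z s e a \<Longrightarrow> val_j Z t e a \<Longrightarrow> sat_j Z (0 \<star> s \<star> t) e E 1"
    and sat_Eq_no: "\<And>s t e E a b. val_j Z s e a \<Longrightarrow> val_j Z t e b \<Longrightarrow> a \<noteq> b \<Longrightarrow>
      sat_j Z (0 \<star> s \<star> t) e E 0"
    and sat_Less_yes: "\<And>s t e E a b. val_j Z s e a \<Longrightarrow> val_j Z t e b \<Longrightarrow> a < b \<Longrightarrow>
      sat_j Z (1 \<star> s \<star> t) e E 1"
    and sat_Less_no: "\<And>s t e E a b. val_j Z s e a \<Longrightarrow> val_j Z t e b \<Longrightarrow> \<not> a < b \<Longrightarrow>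
      sat_j Z (1 \<star> s \<star> t) e E 0"
    and sat_Mem: "\<And>t S e E a b. val_j Z t e a \<Longrightarrow> mem_j Z S E a b \<Longrightarrow> sat_j Z (2 \<star> t \<star> S) e E b"
    and sat_Neg: "\<And>k e E b c. sat_j Z k e E b \<Longrightarrow> b + c = 1 \<Longrightarrow> sat_j Z (3 \<star> k) e E c"
    and sat_Conj: "\<And>k l e E b c. sat_j Z k e E b \<Longrightarrow> sat_j Z l e E c \<Longrightarrow> sat_j Z (4 \<star> k \<star> l) e E (b * c)"
    and sat_AllN_yes: "\<And>j k e E. \<forall>n. sat_j Z k ((j \<star> n) \<rhd> e) E 1 \<Longrightarrow> sat_j Z (5 \<star> j \<star> k) e E 1"
    and sat_AllN_no: "\<And>j k e E n. sat_j Z k ((j \<star> n) \<rhd> e) E 0 \<Longrightarrow> sat_j Z (5 \<star> j \<star> k) e E 0"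
    and sat_AllS_yes: "\<And>j k e E. \<forall>c. sat_j Z k e ((j \<star> c) \<rhd> E) 1 \<Longrightarrow> sat_j Z (6 \<star> j \<star> k) e E 1"
    and sat_AllS_no: "\<And>j k e E c. sat_j Z k e ((j \<star> c) \<rhd> E) 0 \<Longrightarrow> sat_j Z (6 \<star> j \<star> k) e E 0"

lemma arith_pred_saturated: "arith_pred (\<lambda>X Z v. saturated X Z)"
  unfolding saturated_def by (intro arith_intros)

context saturated
begin

text \<open>The lemmas of this context say that all true judgements belong to a saturated set.  The proofs follow
  the structure of the evaluated object.\<close>

lemma Proj_complete: "j < length xs \<Longrightarrow> comp_j Z i (2 \<star> j) (list_encode xs) (xs ! j)"
proof (induction xs arbitrary: j)
  case (Cons x xs)
  then show ?case by (cases j) (auto intro: comp_Proj_0 comp_Proj_Suc)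
qed simp

lemma computes_complete:
  "computes (col Z i) p xs y \<Longrightarrow> comp_j Z i (prog_index p) (list_encode xs) y"
proof (induction rule: computes.induct)
  case (4 x xs)
  then show ?case using comp_Oracle_yes comp_Oracle_no by (simp add: col_def)
next
  case (5 xs qs ys p z)
  have "comps_j Z i (list_encode (map prog_index qs)) (list_encode xs) (list_encode ys)"
    using 5(1) by (induction rule: list_all2_induct) (auto intro: comp_Nil comp_Cons)
  with 5 show ?case by (auto intro: comp_Comp)
next
  case (8 p n xs)
  then show ?case by (auto intro!: comp_Minim)
qed (auto intro: comp_Zero comp_Succ Proj_complete comp_Prim_0 comp_Prim_Suc)

lemma nval_complete:
  "tm_nvars t \<subseteq> fst ` set L \<Longrightarrow> val_j Z (num_term_index t) (assoc_encode L) (nval (env 0 L) t)"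
proof (induction t)
  case (NVar j)
  then show ?case
  proof (induction L)
    case (Cons x L)
    obtain l b where x: "x = (l, b)" by force
    show ?case
    proof (cases "j = l")
      case True
      then show ?thesis using val_NVar_here x by simp
    next
      case False
      with Cons x have "val_j Z (0 \<star> j) (assoc_encode L) (env 0 L j)" by simp
      with False show ?thesis using val_NVar_there x by simp
    qed
  qed simp
qed (auto intro: val_NZero val_NOne val_Plus val_Times)

lemma mem_complete:
  "tm_svars S \<subseteq> fst ` set L \<Longrightarrow> mem_j Z (set_term_index S) (assoc_encode L) x
     (of_bool (x \<in> sval X (\<lambda>j. col Z (env 0 L j)) S))"
proof (cases S)
  case (SVar j)
  assume "tm_svars S \<subseteq> fst ` set L"
  with SVar have "j \<in> fst ` set L" by simp
  then have "mem_j Z (0 \<star> j) (assoc_encode L) x (of_bool (x \<in> col Z (env 0 L j)))"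
  proof (induction L)
    case (Cons y L)
    obtain l c where y: "y = (l, c)" by force
    show ?case
    proof (cases "j = l")
      case True
      then show ?thesis using mem_SVar_yes mem_SVar_no y by (simp add: col_def)
    next
      case False
      with Cons y have "mem_j Z (0 \<star> j) (assoc_encode L) x (of_bool (x \<in> col Z (env 0 L j)))"
        by simp
      with False show ?thesis using mem_SVar_there y by simp
    qed
  qed simp
  with SVar show ?thesis by simp
qed (auto intro: mem_SConst_yes mem_SConst_no)

lemma sat_complete:
  "free_nvars \<phi> \<subseteq> fst ` set L \<Longrightarrow> free_svars \<phi> \<subseteq> fst ` set K \<Longrightarrow>
    sat_j Z (fm_index \<phi>) (assoc_encode L) (assoc_encode K)
      (of_bool (sat (range (col Z)) X (env 0 L) (\<lambda>j. col Z (env 0 K j)) \<phi>))"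
proof (induction \<phi> arbitrary: L K)
  case (Eq s t)
  have s: "val_j Z (num_term_index s) (assoc_encode L) (nval (env 0 L) s)"
    and t: "val_j Z (num_term_index t) (assoc_encode L) (nval (env 0 L) t)"
    using Eq.prems by (simp_all add: nval_complete)
  show ?case
  proof (cases "nval (env 0 L) s = nval (env 0 L) t")
    case True
    with s t have "sat_j Z (0 \<star> num_term_index s \<star> num_term_index t) (assoc_encode L) (assoc_encode K) 1"
      using sat_Eq_yes by metis
    with True show ?thesis by simp
  next
    case False
    with s t have "sat_j Z (0 \<star> num_term_index s \<star> num_term_index t) (assoc_encode L) (assoc_encode K) 0"
      using sat_Eq_no by metis
    with False show ?thesis by simp
  qed
next
  case (Less s t)
  have s: "val_j Z (num_term_index s) (assoc_encode L) (nval (env 0 L) s)"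
    and t: "val_j Z (num_term_index t) (assoc_encode L) (nval (env 0 L) t)"
    using Less.prems by (simp_all add: nval_complete)
  show ?case
  proof (cases "nval (env 0 L) s < nval (env 0 L) t")
    case True
    with s t have "sat_j Z (1 \<star> num_term_index s \<star> num_term_index t) (assoc_encode L) (assoc_encode K) 1"
      using sat_Less_yes by metis
    with True show ?thesis by simp
  next
    case False
    with s t have "sat_j Z (1 \<star> num_term_index s \<star> num_term_index t) (assoc_encode L) (assoc_encode K) 0"
      using sat_Less_no by metis
    with False show ?thesis by simp
  qed
next
  case (Mem t S)
  then show ?case using sat_Mem[OF nval_complete[of t L] mem_complete[of S K]] by auto
next
  case (Neg \<phi>)
  have "sat_j Z (fm_index \<phi>) (assoc_encode L) (assoc_encode K)
      (of_bool (sat (range (col Z)) X (env 0 L) (\<lambda>j. col Z (env 0 K j)) \<phi>))"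
    by (rule Neg.IH) (use Neg.prems in auto)
  from sat_Neg[OF this] show ?case by (simp add: of_bool_def)
next
  case (Conj \<phi> \<psi>)
  have "sat_j Z (fm_index \<phi>) (assoc_encode L) (assoc_encode K)
      (of_bool (sat (range (col Z)) X (env 0 L) (\<lambda>j. col Z (env 0 K j)) \<phi>))"
    by (rule Conj.IH(1)) (use Conj.prems in auto)
  moreover have "sat_j Z (fm_index \<psi>) (assoc_encode L) (assoc_encode K)
      (of_bool (sat (range (col Z)) X (env 0 L) (\<lambda>j. col Z (env 0 K j)) \<psi>))"
    by (rule Conj.IH(2)) (use Conj.prems in auto)
  ultimately show ?case using sat_Conj by (fastforce simp: of_bool_conj)
next
  case (AllN j \<phi>)
  have IH: "sat_j Z (fm_index \<phi>) ((j \<star> n) \<rhd> assoc_encode L) (assoc_encode K)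
      (of_bool (sat (range (col Z)) X ((env 0 L)(j := n)) (\<lambda>i. col Z (env 0 K i)) \<phi>))" for n
  proof -
    have "free_nvars \<phi> \<subseteq> fst ` set ((j, n) # L)" "free_svars \<phi> \<subseteq> fst ` set K"
      using AllN.prems by auto
    from AllN.IH[OF this] show ?thesis by (simp only: env.simps assoc_simps)
  qed
  show ?case
  proof (cases "\<forall>n. sat (range (col Z)) X ((env 0 L)(j := n)) (\<lambda>i. col Z (env 0 K i)) \<phi>")
    case True
    then show ?thesis using sat_AllN_yes IH by simp
  next
    case False
    then obtain n where "\<not> sat (range (col Z)) X ((env 0 L)(j := n)) (\<lambda>i. col Z (env 0 K i)) \<phi>" by blast
    with IH[of n] have "sat_j Z (fm_index \<phi>) ((j \<star> n) \<rhd> assoc_encode L) (assoc_encode K) 0" by simp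
    from sat_AllN_no[OF this] False show ?thesis by auto
  qed
next
  case (AllS j \<phi>)
  have upd: "(\<lambda>i. col Z (env 0 ((j, c) # K) i)) = (\<lambda>i. col Z (env 0 K i))(j := col Z c)" for c
    by (rule ext) simp
  have IH: "sat_j Z (fm_index \<phi>) (assoc_encode L) ((j \<star> c) \<rhd> assoc_encode K)
      (of_bool (sat (range (col Z)) X (env 0 L) ((\<lambda>i. col Z (env 0 K i))(j := col Z c)) \<phi>))" for c
  proof -
    have "free_nvars \<phi> \<subseteq> fst ` set L" "free_svars \<phi> \<subseteq> fst ` set ((j, c) # K)"
      using AllS.prems by auto
    from AllS.IH[OF this] show ?thesis by (simp only: upd assoc_simps)
  qed
  show ?case
  proof (cases "\<forall>c. sat (range (col Z)) X (env 0 L) ((\<lambda>i. col Z (env 0 K i))(j := col Z c)) \<phi>")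
    case True
    then show ?thesis using sat_AllS_yes IH by simp
  next
    case False
    then obtain c where "\<not> sat (range (col Z)) X (env 0 L) ((\<lambda>i. col Z (env 0 K i))(j := col Z c)) \<phi>"
      by blast
    with IH[of c] have "sat_j Z (fm_index \<phi>) (assoc_encode L) ((j \<star> c) \<rhd> assoc_encode K) 0" by simp
    from sat_AllS_no[OF this] False show ?thesis by auto
  qed
qed

end

text \<open>The intended meaning of the judgements, for an \<open>\<omega>\<close>-model enumerated by \<open>A\<close>.\<close>

definition comp_true :: "(nat \<Rightarrow> nat set) \<Rightarrow> nat \<Rightarrow> nat \<Rightarrow> nat \<Rightarrow> nat \<Rightarrow> bool" where
  "comp_true A i p xs y \<longleftrightarrow> computes (A i) (prog_of p) (list_decode xs) y"

definition comps_true :: "(nat \<Rightarrow> nat set) \<Rightarrow> nat \<Rightarrow> nat \<Rightarrow> nat \<Rightarrow> nat \<Rightarrow> bool" where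
  "comps_true A i qs xs ys \<longleftrightarrow>
     list_all2 (\<lambda>q y. computes (A i) q (list_decode xs) y) (map prog_of (list_decode qs)) (list_decode ys)"

definition val_true :: "nat \<Rightarrow> nat \<Rightarrow> nat \<Rightarrow> bool" where
  "val_true s e a \<longleftrightarrow> (\<exists>t. s = num_term_index t \<and> tm_nvars t \<subseteq> fst ` set (assoc_decode e) \<and>
     a = nval (env 0 (assoc_decode e)) t)"

definition mem_true :: "nat set \<Rightarrow> (nat \<Rightarrow> nat set) \<Rightarrow> nat \<Rightarrow> nat \<Rightarrow> nat \<Rightarrow> nat \<Rightarrow> bool" where
  "mem_true X A s E x b \<longleftrightarrow> (\<exists>S. s = set_term_index S \<and> tm_svars S \<subseteq> fst ` set (assoc_decode E) \<and>
     b = of_bool (x \<in> sval X (\<lambda>j. A (env 0 (assoc_decode E) j)) S))"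

definition sat_true :: "nat set \<Rightarrow> (nat \<Rightarrow> nat set) \<Rightarrow> nat \<Rightarrow> nat \<Rightarrow> nat \<Rightarrow> nat \<Rightarrow> bool" where
  "sat_true X A k e E b \<longleftrightarrow> (\<exists>\<phi>. k = fm_index \<phi> \<and> free_nvars \<phi> \<subseteq> fst ` set (assoc_decode e) \<and>
     free_svars \<phi> \<subseteq> fst ` set (assoc_decode E) \<and>
     b = of_bool (sat (range A) X (env 0 (assoc_decode e)) (\<lambda>j. A (env 0 (assoc_decode E) j)) \<phi>))"

definition true_judgements :: "nat set \<Rightarrow> (nat \<Rightarrow> nat set) \<Rightarrow> nat set" where
  "true_judgements X A =
     {0 \<star> i \<star> x | i x. x \<in> A i} \<union>
     {1 \<star> i \<star> p \<star> xs \<star> y | i p xs y. comp_true A i p xs y} \<union>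
     {2 \<star> i \<star> qs \<star> xs \<star> ys | i qs xs ys. comps_true A i qs xs ys} \<union>
     {3 \<star> t \<star> e \<star> a | t e a. val_true t e a} \<union>
     {4 \<star> S \<star> E \<star> x \<star> b | S E x b. mem_true X A S E x b} \<union>
     {5 \<star> k \<star> e \<star> E \<star> b | k e E b. sat_true X A k e E b}"

lemma true_judgements_iff:
  "0 \<star> i \<star> x \<in> true_judgements X A \<longleftrightarrow> x \<in> A i"
  "comp_j (true_judgements X A) i p xs y \<longleftrightarrow> comp_true A i p xs y"
  "comps_j (true_judgements X A) i qs xs ys \<longleftrightarrow> comps_true A i qs xs ys"
  "val_j (true_judgements X A) t e a \<longleftrightarrow> val_true t e a"
  "mem_j (true_judgements X A) S E x b \<longleftrightarrow> mem_true X A S E x b"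
  "sat_j (true_judgements X A) k e E b \<longleftrightarrow> sat_true X A k e E b"
  by (simp_all add: true_judgements_def)

lemma env_upd_comp: "(\<lambda>i. A (env 0 ((j, c) # K) i)) = (\<lambda>i. A (env 0 K i))(j := A c)"
  by (rule ext) simp

text \<open>The rules are sound.  This is where the totality of \<^const>\<open>prog_of\<close> is used, as well as the injectivity of
  \<^const>\<open>fm_index\<close>: the infinitely many premises of a universal quantifier must concern the same formula.
  The cases below are numbered in the order of the rules.\<close>

lemma saturated_true_judgements: "saturated X (true_judgements X A)"
proof (unfold_locales, unfold true_judgements_iff, goal_cases)
  case (4 i j x xs y)
  then show ?case by (auto simp: comp_true_def intro!: computes_Proj)
next
  case (5 i x xs)
  then show ?case using computes.intros(4)[of "A i" x "list_decode xs"] by (simp add: comp_true_def)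
next
  case (6 i x xs)
  then show ?case using computes.intros(4)[of "A i" x "list_decode xs"] by (simp add: comp_true_def)
next
  case (9 i p qs xs ys z)
  then show ?case by (auto simp: comp_true_def comps_true_def intro: computes.intros(5))
next
  case (12 i p n xs)
  then show ?case by (auto simp: comp_true_def intro: computes.intros(8))
next
  case (13 j a e)
  show ?case unfolding val_true_def by (rule exI[of _ "NVar j"]) simp
next
  case (14 j l a b e)
  from 14(2) obtain t where t: "0 \<star> j = num_term_index t" "tm_nvars t \<subseteq> fst ` set (assoc_decode e)"
    "a = nval (env 0 (assoc_decode e)) t"
    unfolding val_true_def by blast
  from t(1) have "t = NVar j" by (cases t) auto
  with t 14(1) show ?case unfolding val_true_def by (intro exI[of _ t]) auto
next
  case (15 e)
  show ?case unfolding val_true_def by (rule exI[of _ NZero]) simp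
next
  case (16 e)
  show ?case unfolding val_true_def by (rule exI[of _ NOne]) simp
next
  case (17 s t e a b)
  then show ?case unfolding val_true_def by (elim exE conjE, rule_tac x = "Plus ta taa" in exI) simp
next
  case (18 s t e a b)
  then show ?case unfolding val_true_def by (elim exE conjE, rule_tac x = "Times ta taa" in exI) simp
next
  case (19 j c E x)
  then show ?case unfolding mem_true_def by (intro exI[of _ "SVar j"]) simp
next
  case (20 j c E x)
  then show ?case unfolding mem_true_def by (intro exI[of _ "SVar j"]) simp
next
  case (21 j l c E x b)
  from 21(2) obtain S where S: "0 \<star> j = set_term_index S" "tm_svars S \<subseteq> fst ` set (assoc_decode E)"
    "b = of_bool (x \<in> sval X (\<lambda>j. A (env 0 (assoc_decode E) j)) S)"
    unfolding mem_true_def by blast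
  from S(1) have "S = SVar j" by (cases S) auto
  with S 21(1) show ?case unfolding mem_true_def by (intro exI[of _ S]) auto
next
  case (22 E x)
  then show ?case unfolding mem_true_def by (intro exI[of _ SConst]) simp
next
  case (23 E x)
  then show ?case unfolding mem_true_def by (intro exI[of _ SConst]) simp
next
  case (24 s t e E a)
  then show ?case unfolding val_true_def sat_true_def
    by (elim exE conjE, rule_tac x = "Eq ta taa" in exI) simp
next
  case (25 s t e E a b)
  then show ?case unfolding val_true_def sat_true_def
    by (elim exE conjE, rule_tac x = "Eq ta taa" in exI) simp
next
  case (26 s t e E a b)
  then show ?case unfolding val_true_def sat_true_def
    by (elim exE conjE, rule_tac x = "Less ta taa" in exI) simp
next
  case (27 s t e E a b)
  then show ?case unfolding val_true_def sat_true_def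
    by (elim exE conjE, rule_tac x = "Less ta taa" in exI) simp
next
  case (28 t S e E a b)
  then show ?case unfolding val_true_def mem_true_def sat_true_def
    by (elim exE conjE, rule_tac x = "Mem ta Sa" in exI) simp
next
  case (29 k e E b c)
  then show ?case unfolding sat_true_def
    by (elim exE conjE, rule_tac x = "Neg \<phi>" in exI) (auto simp: of_bool_def split: if_splits)
next
  case (30 k l e E b c)
  then show ?case unfolding sat_true_def
    by (elim exE conjE, rule_tac x = "Conj \<phi> \<phi>'" in exI) auto
next
  case (31 j k e E)
  from 31[rule_format, of 0] obtain \<phi> where \<phi>: "k = fm_index \<phi>"
    "free_nvars \<phi> \<subseteq> insert j (fst ` set (assoc_decode e))" "free_svars \<phi> \<subseteq> fst ` set (assoc_decode E)"
    unfolding sat_true_def by auto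
  have "sat (range A) X ((env 0 (assoc_decode e))(j := n)) (\<lambda>i. A (env 0 (assoc_decode E) i)) \<phi>" for n
    using 31[rule_format, of n] by (auto simp: sat_true_def \<phi>(1) fm_index_inject)
  with \<phi> show ?case unfolding sat_true_def by (intro exI[of _ "AllN j \<phi>"]) auto
next
  case (32 j k e E n)
  then obtain \<phi> where \<phi>: "k = fm_index \<phi>"
    "free_nvars \<phi> \<subseteq> insert j (fst ` set (assoc_decode e))" "free_svars \<phi> \<subseteq> fst ` set (assoc_decode E)"
    "\<not> sat (range A) X ((env 0 (assoc_decode e))(j := n)) (\<lambda>i. A (env 0 (assoc_decode E) i)) \<phi>"
    unfolding sat_true_def by auto
  then show ?case unfolding sat_true_def by (intro exI[of _ "AllN j \<phi>"]) auto
next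
  case (33 j k e E)
  from 33[rule_format, of 0] obtain \<phi> where \<phi>: "k = fm_index \<phi>"
    "free_nvars \<phi> \<subseteq> fst ` set (assoc_decode e)" "free_svars \<phi> \<subseteq> insert j (fst ` set (assoc_decode E))"
    unfolding sat_true_def by auto
  have "sat (range A) X (env 0 (assoc_decode e)) ((\<lambda>i. A (env 0 (assoc_decode E) i))(j := A c)) \<phi>" for c
    using 33[rule_format, of c] unfolding sat_true_def assoc_simps env_upd_comp \<phi>(1) fm_index_inject
    by (auto simp del: fun_upd_apply)
  with \<phi> show ?case unfolding sat_true_def by (intro exI[of _ "AllS j \<phi>"]) auto
next
  case (34 j k e E c)
  then obtain \<phi> where \<phi>: "k = fm_index \<phi>"
    "free_nvars \<phi> \<subseteq> fst ` set (assoc_decode e)" "free_svars \<phi> \<subseteq> insert j (fst ` set (assoc_decode E))"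
    "\<not> sat (range A) X (env 0 (assoc_decode e)) ((\<lambda>i. A (env 0 (assoc_decode E) i))(j := A c)) \<phi>"
    unfolding sat_true_def assoc_simps env_upd_comp by (auto simp del: fun_upd_apply)
  then show ?case unfolding sat_true_def by (intro exI[of _ "AllS j \<phi>"]) auto
qed (auto simp: comp_true_def comps_true_def intro: computes.intros computes_Proj)

section \<open>Countable submodels\<close>

lemma turing_leI: "(\<And>x. computes A p [x] (if x \<in> B then 1 else 0)) \<Longrightarrow> B \<le>\<^sub>T A"
  unfolding turing_le_def computable_in_def by blast

lemma turing_leE:
  assumes "B \<le>\<^sub>T A"
  obtains p where "\<And>x. computes A p [x] (if x \<in> B then 1 else 0)"
  using assms unfolding turing_le_def computable_in_def by blast

lemma empty_mem_ideal:
  assumes "turing_ideal M" "X \<in> M"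
  shows "{} \<in> M"
proof -
  have "{} \<le>\<^sub>T X" by (rule turing_leI[where p = Zero]) (auto intro: computes.intros)
  with assms show ?thesis unfolding turing_ideal_def by blast
qed

instance num_term :: countable by countable_datatype
instance set_term :: countable by countable_datatype
instance fm :: countable by countable_datatype
instance prog :: countable by countable_datatype

text \<open>Names for the elements of a countable submodel: the parameter, sets computed by a program from a
  named set, joins, and Skolem witnesses against a formula.  Instead of closing a set of sets in
  stages, the submodel is obtained as the range of an interpretation of this countable type.\<close>

datatype hull_term =
    Param
  | Reduct prog hull_term
  | Join hull_term hull_term
  | Witness fm nat "(nat \<times> nat) list" "(nat \<times> hull_term) list"

instance hull_term :: countable by countable_datatype

context
  fixes M :: "nat set set" and X :: "nat set"
begin

text \<open>The parameter also serves as the value where a set of the named kind is missing from \<open>M\<close>.  A witness carries the finitely many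
  values that are relevant for its formula.\<close>

primrec hull_val :: "hull_term \<Rightarrow> nat set" where
  "hull_val Param = X"
| "hull_val (Reduct p t) =
    (if {x. computes (hull_val t) p [x] 1} \<in> M then {x. computes (hull_val t) p [x] 1} else X)"
| "hull_val (Join s t) = hull_val s \<oplus> hull_val t"
| "hull_val (Witness \<phi> i L K) =
    (let E = env X (map (map_prod id hull_val) K) in
     if \<exists>Y\<in>M. \<not> sat M X (env 0 L) (E(i := Y)) \<phi>
     then SOME Y. Y \<in> M \<and> \<not> sat M X (env 0 L) (E(i := Y)) \<phi> else X)"

definition hull :: "nat set set" where
  "hull = range hull_val"

lemma hull_subset:
  assumes "turing_ideal M" "X \<in> M"
  shows "hull \<subseteq> M"
proof -
  have "hull_val t \<in> M" for t
  proof (induction t)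
    case (Join s t)
    then show ?case using assms(1) by (simp add: turing_ideal_def)
  next
    case (Witness \<phi> i L K)
    define P where "P = (\<lambda>Y. Y \<in> M \<and> \<not> sat M X (env 0 L) ((env X (map (map_prod id hull_val) K))(i := Y)) \<phi>)"
    have "(SOME Y. P Y) \<in> M" if "\<exists>Y. P Y" using someI_ex[OF that] by (simp add: P_def)
    then show ?case using assms(2) by (auto simp: P_def Bex_def Let_def)
  qed (use assms(2) in auto)
  then show ?thesis by (auto simp: hull_def)
qed

lemma param_mem_hull: "X \<in> hull"
  unfolding hull_def by (metis hull_val.simps(1) rangeI)

lemma turing_ideal_hull:
  assumes "turing_ideal M" "X \<in> M"
  shows "turing_ideal hull"
  unfolding turing_ideal_def
proof (intro conjI allI impI)
  fix A B assume "A \<in> hull" "B \<le>\<^sub>T A"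
  obtain t where t: "A = hull_val t" using \<open>A \<in> hull\<close> unfolding hull_def by blast
  obtain p where p: "\<And>x. computes A p [x] (if x \<in> B then 1 else 0)"
    using \<open>B \<le>\<^sub>T A\<close> by (rule turing_leE) (rule that)
  have "B = {x. computes A p [x] 1}"
  proof (rule set_eqI)
    fix x show "x \<in> B \<longleftrightarrow> x \<in> {x. computes A p [x] 1}"
      using p[of x] computes_functional[of A p "[x]" 0 1] by (cases "x \<in> B") auto
  qed
  moreover have "B \<in> M"
    using assms \<open>A \<in> hull\<close> \<open>B \<le>\<^sub>T A\<close> hull_subset[OF assms] unfolding turing_ideal_def by blast
  ultimately have "B = hull_val (Reduct p t)" by (simp add: t)
  then show "B \<in> hull" unfolding hull_def by (rule range_eqI)
next
  fix A B assume "A \<in> hull" "B \<in> hull"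
  then obtain s t where "A = hull_val s" "B = hull_val t" unfolding hull_def by blast
  then have "A \<oplus> B = hull_val (Join s t)" by simp
  then show "A \<oplus> B \<in> hull" unfolding hull_def by (rule range_eqI)
qed

text \<open>The Tarski-Vaught argument.  It is confined to environments with finitely many entries, because only
  these are covered by the countably many witnesses.\<close>

lemma sat_hull:
  assumes "turing_ideal M" "X \<in> M"
  shows "sat hull X (env 0 L) (env X (map (map_prod id hull_val) K)) \<phi> \<longleftrightarrow>
    sat M X (env 0 L) (env X (map (map_prod id hull_val) K)) \<phi>"
proof (induction \<phi> arbitrary: L K)
  case (AllN i \<phi>)
  have "sat hull X ((env 0 L)(i := n)) (env X (map (map_prod id hull_val) K)) \<phi> \<longleftrightarrow>
    sat M X ((env 0 L)(i := n)) (env X (map (map_prod id hull_val) K)) \<phi>" for n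
    using AllN[of "(i, n) # L"] by (simp only: env.simps)
  then show ?case by (simp only: sat.simps)
next
  case (AllS i \<phi>)
  let ?E = "env X (map (map_prod id hull_val) K)"
  have IH: "sat hull X (env 0 L) (?E(i := hull_val t)) \<phi> \<longleftrightarrow> sat M X (env 0 L) (?E(i := hull_val t)) \<phi>" for t
  proof -
    have "?E(i := hull_val t) = env X (map (map_prod id hull_val) ((i, t) # K))" by simp
    then show ?thesis by (simp only: AllS)
  qed
  define P where "P = (\<lambda>Y. Y \<in> M \<and> \<not> sat M X (env 0 L) (?E(i := Y)) \<phi>)"
  have "P (hull_val (Witness \<phi> i L K))" if "P Y" for Y
  proof -
    have "P (SOME Y. P Y)" using that by (rule someI)
    moreover have "hull_val (Witness \<phi> i L K) = (SOME Y. P Y)"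
      using that by (auto simp: P_def Bex_def Let_def)
    ultimately show ?thesis by simp
  qed
  then have "(\<forall>Y\<in>M. sat M X (env 0 L) (?E(i := Y)) \<phi>) \<longleftrightarrow> (\<forall>t. sat M X (env 0 L) (?E(i := hull_val t)) \<phi>)"
    using hull_subset[OF assms] unfolding P_def hull_def by blast
  moreover have "(\<forall>Y\<in>hull. Q Y) \<longleftrightarrow> (\<forall>t. Q (hull_val t))" for Q
    unfolding hull_def by blast
  ultimately show ?case by (simp only: sat.simps IH)
qed auto

end

text \<open>Countable models suffice to refute entailment, and a countable model can be coded by one set.\<close>

lemma countable_countermodel:
  assumes "turing_ideal M" "X \<in> M" "sentence \<phi>" "\<not> sat M X e E \<phi>"
  obtains A :: "nat \<Rightarrow> nat set" where "turing_ideal (range A)" "X \<in> range A"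
    "\<And>e E. \<not> sat (range A) X e E \<phi>"
proof
  let ?A = "\<lambda>n. hull_val M X (from_nat n)"
  have range: "range ?A = hull M X"
    unfolding hull_def by (auto, metis from_nat_to_nat rangeI)
  show "turing_ideal (range ?A)" "X \<in> range ?A"
    unfolding range by (rule turing_ideal_hull[OF assms(1,2)] param_mem_hull)+
  have "\<not> sat (hull M X) X (env 0 []) (env X (map (map_prod id (hull_val M X)) [])) \<phi>"
    unfolding sat_hull[OF assms(1,2)] using assms(3,4) sat_sentence by blast
  then show "\<not> sat (range ?A) X e E \<phi>" for e E
    unfolding range using assms(3) sat_sentence by blast
qed

section \<open>Definability of computable entailment\<close>

text \<open>The next four conditions are arithmetical and, with the columns of \<open>Z\<close> fixed, positive in the judgements.  They
  therefore follow for every saturated set once they hold for the true judgements about its columns.\<close>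

definition omits_param :: "nat set \<Rightarrow> nat set \<Rightarrow> bool" where
  "omits_param X Z \<longleftrightarrow> (\<forall>i. \<exists>x. \<not> (0 \<star> i \<star> x \<in> Z \<longleftrightarrow> x \<in> X))"

definition omits_join :: "nat set \<Rightarrow> bool" where
  "omits_join Z \<longleftrightarrow> (\<exists>i j. \<forall>k. \<exists>x. \<not> ((0 \<star> k \<star> (2 * x) \<in> Z \<longleftrightarrow> 0 \<star> i \<star> x \<in> Z) \<and>
     (0 \<star> k \<star> (2 * x + 1) \<in> Z \<longleftrightarrow> 0 \<star> j \<star> x \<in> Z)))"

text \<open>A program with an oracle column that takes only the values 0 and 1 and disagrees with each column
  somewhere.\<close>

definition omits_reduct :: "nat set \<Rightarrow> bool" where
  "omits_reduct Z \<longleftrightarrow> (\<exists>i q. (\<forall>x. comp_j Z i q (x \<rhd> 0) 0 \<or> comp_j Z i q (x \<rhd> 0) 1) \<and>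
     (\<forall>j. \<exists>x. 0 \<star> j \<star> x \<in> Z \<and> comp_j Z i q (x \<rhd> 0) 0 \<or>
       \<not> 0 \<star> j \<star> x \<in> Z \<and> comp_j Z i q (x \<rhd> 0) 1))"

text \<open>The program \<open>p\<close> computes codes from indices.  Its empty oracle is found among the columns.\<close>

definition verifies_code :: "nat \<Rightarrow> nat set \<Rightarrow> nat \<Rightarrow> bool" where
  "verifies_code p Z m \<longleftrightarrow>
     (\<exists>i k. (\<forall>x. \<not> 0 \<star> i \<star> x \<in> Z) \<and> comp_j Z i p (k \<rhd> 0) m \<and> sat_j Z k 0 0 1)"

text \<open>Suppose that \<open>p\<close> codes a program for the coding of sentences and that \<open>m\<close> is the code of \<open>\<phi>\<close>.  Then this
  holds for all \<open>Z\<close> iff \<open>\<phi>\<close> is entailed: \<open>Z\<close> could fail only by coding a Turing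
  ideal that contains \<open>X\<close> and does not satisfy \<open>\<phi>\<close>.\<close>

definition no_countermodel :: "nat \<Rightarrow> nat set \<Rightarrow> nat set \<Rightarrow> nat \<Rightarrow> bool" where
  "no_countermodel p X Z m \<longleftrightarrow>
     (saturated X Z \<longrightarrow> omits_param X Z \<or> omits_join Z \<or> omits_reduct Z \<or> verifies_code p Z m)"

lemma arith_pred_no_countermodel: "arith_pred (\<lambda>X Z m. no_countermodel p X Z m)"
  unfolding no_countermodel_def omits_param_def omits_join_def omits_reduct_def verifies_code_def
  by (intro arith_intros arith_pred_saturated)

lemma mem_rec_join [simp]: "2 * x \<in> A \<oplus> B \<longleftrightarrow> x \<in> A" "2 * x + 1 \<in> A \<oplus> B \<longleftrightarrow> x \<in> B"
  unfolding rec_join_def by (auto; presburger)+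

lemma rec_join_eqI:
  assumes "\<And>x. 2 * x \<in> C \<longleftrightarrow> x \<in> A" "\<And>x. 2 * x + 1 \<in> C \<longleftrightarrow> x \<in> B"
  shows "C = A \<oplus> B"
proof (rule set_eqI)
  fix y show "y \<in> C \<longleftrightarrow> y \<in> A \<oplus> B"
    using assms by (cases "even y") (auto elim!: evenE oddE)
qed

context saturated
begin

lemma in_col: "x \<in> col Z i \<longleftrightarrow> 0 \<star> i \<star> x \<in> Z"
  by (simp add: col_def)

text \<open>If a set is reducible to a column, then \<open>Z\<close> contains the true judgements about the reduction.  These
  cannot conflict with every column, and a column without a conflict equals the set.\<close>

lemma turing_ideal_columns:
  assumes "\<not> omits_join Z" "\<not> omits_reduct Z"
  shows "turing_ideal (range (col Z))"
  unfolding turing_ideal_def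
proof (intro conjI allI impI)
  fix A B assume "A \<in> range (col Z)" "B \<le>\<^sub>T A"
  then obtain i where "B \<le>\<^sub>T col Z i" by blast
  then obtain p where p: "\<And>x. computes (col Z i) p [x] (if x \<in> B then 1 else 0)"
    by (rule turing_leE) (rule that)
  have halts: "comp_j Z i (prog_index p) (x \<rhd> 0) (if x \<in> B then 1 else 0)" for x
    using computes_complete[OF p[of x]] by simp
  then have "\<forall>x. comp_j Z i (prog_index p) (x \<rhd> 0) 0 \<or> comp_j Z i (prog_index p) (x \<rhd> 0) 1"
    by metis
  with assms(2) obtain k where k: "\<forall>x. \<not> (0 \<star> k \<star> x \<in> Z \<and> comp_j Z i (prog_index p) (x \<rhd> 0) 0 \<or>
      \<not> 0 \<star> k \<star> x \<in> Z \<and> comp_j Z i (prog_index p) (x \<rhd> 0) 1)"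
    unfolding omits_reduct_def by meson
  have "x \<in> B \<longleftrightarrow> 0 \<star> k \<star> x \<in> Z" for x using halts[of x] k by (auto split: if_splits)
  then have "B = col Z k" by (auto simp: col_def)
  then show "B \<in> range (col Z)" by blast
next
  fix A B assume "A \<in> range (col Z)" "B \<in> range (col Z)"
  then obtain i j where ij: "A = col Z i" "B = col Z j" by blast
  have closed: "\<forall>i j. \<exists>k. \<forall>x. (0 \<star> k \<star> (2 * x) \<in> Z \<longleftrightarrow> 0 \<star> i \<star> x \<in> Z) \<and>
      (0 \<star> k \<star> (2 * x + 1) \<in> Z \<longleftrightarrow> 0 \<star> j \<star> x \<in> Z)"
    using assms(1) unfolding omits_join_def by (simp only: not_ex not_all not_not simp_thms)
  then obtain k where k: "\<forall>x. (0 \<star> k \<star> (2 * x) \<in> Z \<longleftrightarrow> 0 \<star> i \<star> x \<in> Z) \<and>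
      (0 \<star> k \<star> (2 * x + 1) \<in> Z \<longleftrightarrow> 0 \<star> j \<star> x \<in> Z)"
    using closed[THEN spec[of _ i], THEN spec[of _ j]] by (elim exE)
  have "col Z k = A \<oplus> B" by (rule rec_join_eqI) (simp_all add: ij in_col k)
  then show "A \<oplus> B \<in> range (col Z)" by (metis rangeI)
qed

lemma verifies_entailed_code:
  assumes "comp_entailed X \<phi>" "sentence \<phi>" and ideal: "turing_ideal (range (col Z))" "X \<in> range (col Z)"
    and "computes {} P [fm_index \<phi>] m"
  shows "verifies_code (prog_index P) Z m"
proof -
  obtain i where i: "col Z i = {}" using empty_mem_ideal[OF ideal] by auto
  then have "\<forall>x. \<not> 0 \<star> i \<star> x \<in> Z" by (auto simp: col_def)
  moreover have "comp_j Z i (prog_index P) (fm_index \<phi> \<rhd> 0) m"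
  proof -
    have "computes (col Z i) P [fm_index \<phi>] m" using assms(5) by (simp only: i)
    from computes_complete[OF this] show ?thesis by simp
  qed
  moreover have "sat_j Z (fm_index \<phi>) 0 0 1"
  proof -
    have "models (range (col Z)) X \<phi>" using assms(1) ideal unfolding comp_entailed_def by blast
    moreover have "range (\<lambda>j. col Z (env 0 [] j)) \<subseteq> range (col Z)" by auto
    ultimately have "sat (range (col Z)) X (env 0 []) (\<lambda>j. col Z (env 0 [] j)) \<phi>"
      by (simp only: models_def)
    then show ?thesis using sat_complete[of \<phi> "[]" "[]"] assms(2) by (simp add: sentence_def)
  qed
  ultimately show ?thesis unfolding verifies_code_def by blast
qed

end

lemma no_countermodel_complete:
  assumes "comp_entailed X \<phi>" "sentence \<phi>" "computes {} P [fm_index \<phi>] m"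
  shows "no_countermodel (prog_index P) X Z m"
  unfolding no_countermodel_def
proof (intro impI)
  assume "saturated X Z"
  then interpret saturated X Z .
  have "X \<in> range (col Z)" if "\<not> omits_param X Z"
  proof -
    from that obtain i where "\<forall>x. 0 \<star> i \<star> x \<in> Z \<longleftrightarrow> x \<in> X"
      unfolding omits_param_def by (auto simp only: not_all not_ex not_not simp_thms)
    then have "X = col Z i" by (auto simp: col_def)
    then show ?thesis by blast
  qed
  then show "omits_param X Z \<or> omits_join Z \<or> omits_reduct Z \<or> verifies_code (prog_index P) Z m"
    using turing_ideal_columns verifies_entailed_code[OF assms(1,2) _ _ assms(3)] by blast
qed

text \<open>In the true judgements each program computes at most one value.  A column which equals the set computed
  by a program therefore disagrees with it nowhere.\<close>

lemma nothing_omitted: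
  assumes ideal: "turing_ideal (range A)" and "X \<in> range A"
  defines "Z \<equiv> true_judgements X A"
  shows "\<not> omits_param X Z" "\<not> omits_join Z" "\<not> omits_reduct Z"
proof -
  show "\<not> omits_param X Z"
    using assms(2) unfolding omits_param_def Z_def true_judgements_iff by blast
  have "\<exists>k. \<forall>x. (2 * x \<in> A k \<longleftrightarrow> x \<in> A i) \<and> (2 * x + 1 \<in> A k \<longleftrightarrow> x \<in> A j)" for i j
  proof -
    have "A i \<oplus> A j \<in> range A" using ideal unfolding turing_ideal_def by blast
    then obtain k where "A k = A i \<oplus> A j" by (metis imageE)
    then show ?thesis by (metis mem_rec_join)
  qed
  then show "\<not> omits_join Z"
    unfolding omits_join_def Z_def true_judgements_iff by (simp only: not_ex not_all not_not simp_thms)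
  show "\<not> omits_reduct Z"
    unfolding omits_reduct_def Z_def true_judgements_iff comp_true_def
  proof (intro notI, elim exE conjE)
    fix i q
    let ?halts = "\<lambda>x y. computes (A i) (prog_of q) (list_decode (x \<rhd> 0)) y"
    assume total: "\<forall>x. ?halts x 0 \<or> ?halts x 1"
      and omitted: "\<forall>j. \<exists>x. x \<in> A j \<and> ?halts x 0 \<or> x \<notin> A j \<and> ?halts x 1"
    let ?B = "{x. ?halts x 1}"
    have "computes (A i) (prog_of q) [x] (if x \<in> ?B then 1 else 0)" for x using total by auto
    then have "?B \<le>\<^sub>T A i" by (rule turing_leI)
    then have "?B \<in> range A" using ideal unfolding turing_ideal_def by blast
    then obtain j where j: "A j = ?B" by (metis imageE)
    obtain x where "x \<in> A j \<and> ?halts x 0 \<or> x \<notin> A j \<and> ?halts x 1" using omitted by blast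
    then have "?halts x 1 \<and> ?halts x 0" by (simp only: j mem_Collect_eq) blast
    then show False using computes_functional by fastforce
  qed
qed

lemma verified_code_true:
  assumes "verifies_code (prog_index P) (true_judgements X A) m"
  obtains \<phi> where "sentence \<phi>" "computes {} P [fm_index \<phi>] m" "\<And>e E. sat (range A) X e E \<phi>"
proof -
  obtain i k where i: "\<forall>x. x \<notin> A i" and k: "comp_true A i (prog_index P) (k \<rhd> 0) m" "sat_true X A k 0 0 1"
    using assms unfolding verifies_code_def true_judgements_iff by blast
  obtain \<phi> where \<phi>: "k = fm_index \<phi>" "sentence \<phi>" "sat (range A) X (env 0 []) (\<lambda>j. A (env 0 [] j)) \<phi>"
    using k(2) by (auto simp: sat_true_def sentence_def of_bool_def split: if_splits)
  have "A i = {}" using i by blast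
  with k(1) have "computes {} P [fm_index \<phi>] m" by (simp add: comp_true_def prog_of_prog_index \<phi>(1))
  moreover have "sat (range A) X e E \<phi>" for e E using \<phi>(2,3) sat_sentence by blast
  ultimately show thesis using that \<phi>(2) by blast
qed

text \<open>Since the coding is bijective on sentences, the sentence verified by the true judgements of a
  countable model is the one whose code was given.\<close>

lemma comp_entailment_Pi11:
  assumes "goedel_coding code"
  shows "comp_entailment code X \<in> Pi11 X"
proof -
  obtain f P where f: "\<And>\<phi>. sentence \<phi> \<Longrightarrow> code \<phi> = f (fm_index \<phi>)" and P: "\<And>x. computes {} P [x] (f x)"
    using assms unfolding goedel_coding_def recursive_fun_def computable_in_def by blast
  have "m \<in> comp_entailment code X \<longleftrightarrow>
      (\<forall>Z. no_countermodel (prog_index P) X Z m)" for m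
  proof
    assume "m \<in> comp_entailment code X"
    then obtain \<phi> where "sentence \<phi>" "comp_entailed X \<phi>" "f (fm_index \<phi>) = m"
      using f unfolding comp_entailment_def by auto
    then show "\<forall>Z. no_countermodel (prog_index P) X Z m"
      using no_countermodel_complete P by metis
  next
    assume no: "\<forall>Z. no_countermodel (prog_index P) X Z m"
    obtain \<phi> where \<phi>: "sentence \<phi>" "code \<phi> = m"
      using assms unfolding goedel_coding_def bij_betw_def by (metis UNIV_I imageE mem_Collect_eq)
    have "comp_entailed X \<phi>"
    proof (rule ccontr)
      assume "\<not> comp_entailed X \<phi>"
      then obtain M e E where M: "turing_ideal M" "X \<in> M" "\<not> sat M X e E \<phi>"
        unfolding comp_entailed_def models_def by blast
      obtain A :: "nat \<Rightarrow> nat set" where A: "turing_ideal (range A)" "X \<in> range A"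
        "\<And>e E. \<not> sat (range A) X e E \<phi>"
        by (rule countable_countermodel[OF M(1,2) \<phi>(1) M(3)]) (rule that)
      have "verifies_code (prog_index P) (true_judgements X A) m"
        using no nothing_omitted[OF A(1,2)] saturated_true_judgements unfolding no_countermodel_def by blast
      then obtain \<psi> where \<psi>: "sentence \<psi>" "computes {} P [fm_index \<psi>] m"
        "\<And>e E. sat (range A) X e E \<psi>"
        by (rule verified_code_true) (rule that)
      have "code \<psi> = m" using f[OF \<psi>(1)] computes_functional[OF P \<psi>(2)] by simp
      then have "\<psi> = \<phi>"
        using assms \<phi> \<psi>(1) unfolding goedel_coding_def bij_betw_def inj_on_def by blast
      with A(3) \<psi>(3) show False by blast
    qed
    with \<phi> show "m \<in> comp_entailment code X" unfolding comp_entailment_def by blast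
  qed
  then have "comp_entailment code X =
      {m. \<forall>Z. no_countermodel (prog_index P) X Z m}" by blast
  also have "\<dots> \<in> Pi11 X" by (rule Pi11_of_arith_pred[OF arith_pred_no_countermodel])
  finally show ?thesis .
qed

theorem theorem7p2:
  fixes code :: "fm \<Rightarrow> nat" and X :: "nat set"
  assumes "goedel_coding code"
  shows "complete_for (Pi11 X) (comp_entailment code X)"
  unfolding complete_for_def
  using comp_entailment_Pi11[OF assms] one_le_comp_entailment[OF assms] by blast

end
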